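(* The rotation surfaces $\psi_{[U,n,0]}(u,t)$, with $n\neq0$, give rise in the BCV-space $\mathcal N_{\kappa,\tau}$ to a $1$-parameter family of isometric surfaces that are also isometric to the helicoidal surfaces $\psi_{[U,m,a]}(u,t)$ (same function $U$). This family is determined by the formulas $$\begin{aligned}\xi_1(u)&=\frac{2nU}{\sqrt{2(1+\sqrt\Delta)-\kappa n^2U^2}},\\ \xi_2(u)&=\int\sqrt{\frac{(1+\sqrt\Delta)^2}{2(1+\sqrt\Delta)-\kappa n^2U^2}-\frac{n^2(1+\sqrt\Delta)^4U'^2}{\Delta[2(1+\sqrt\Delta)-\kappa n^2U^2]^2}}\,du,\\ \theta(u,t)&=\frac tn+2\tau\int\sqrt{\frac{1}{2(1+\sqrt\Delta)-\kappa n^2U^2}-\frac{n^2(1+\sqrt\Delta)^2U'^2}{\Delta[2(1+\sqrt\Delta)-\kappa n^2U^2]^2}}\,du,\end{aligned}$$ where $\Delta=1+(4\tau^2-\kappa)n^2U^2$. In particular: (1) if $\kappa=4\tau^2\ne0$, i.e. $\mathcal N_{\kappa,\tau}\cong\mathbb S^3(\tau^2)$, these become $$\xi_1=\frac{nU}{\sqrt{1-\tau^2n^2U^2}},\quad \xi_2=\int\frac{\sqrt{1-n^2(\tau^2U^2+U'^2)}}{1-\tau^2n^2U^2}\,du,\quad \theta=\frac tn+\tau\int\frac{\sqrt{1-n^2(\tau^2U^2+U'^2)}}{1-\tau^2n^2U^2}\,du;$$ (2) if $\tau=0$, i.e. $\mathcal N_{\kappa,\tau}\cong\mathbb R^3$,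 $\mathbb S^2(\kappa)\times\mathbb R$ or $\mathbb H^2(\kappa)\times\mathbb R$, these become $$\xi_1=\frac{2nU}{1+\sqrt{1-\kappa n^2U^2}},\quad \xi_2=\int\sqrt{\frac{1-n^2(\kappa U^2+U'^2)}{1-\kappa n^2U^2}}\,du,\quad\theta=\frac tn;$$ (3) if $\kappa=0$ and $\tau\ne0$, i.e. $\mathcal N_{\kappa,\tau}\cong\mathbb H_3$ (Heisenberg group), these become, with $\Delta=1+4\tau^2n^2U^2$, $$\xi_1=\frac{\sqrt2\,nU}{\sqrt{1+\sqrt\Delta}},\quad \xi_2=\int\frac{1+\sqrt\Delta}{2}\sqrt{\frac{2}{1+\sqrt\Delta}-\frac{n^2U'^2}{\Delta}}\,du,\quad \theta=\frac tn+\tau\int\sqrt{\frac{2}{1+\sqrt\Delta}-\frac{n^2U'^2}{\Delta}}\,du;$$ (4) if $\kappa\ne0$ and $\tau\ne0$, the general formulas give the family of rotation surfaces in the cases $\mathcal N_{\kappa,\tau}\cong\mathrm{SU}(2)$ and $\mathcal N_{\kappa,\tau}\cong\widetilde{\mathrm{SL}(2,\mathbb R)}$.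
   Context: For $\kappa,\tau\in\mathbb R$, the Bianchi-Cartan-Vranceanu (BCV) space $\mathcal N_{\kappa,\tau}$ is the open subset of $\mathbb R^3$ where $B=1+\frac{\kappa}{4}(x^2+y^2)>0$, with the metric $g_{\kappa,\tau}=\frac{dx^2+dy^2}{B^2}+\big(dz+\tau\frac{y\,dx-x\,dy}{B}\big)^2$. Cylindrical coordinates $(r,\theta,z)$ with $x=r\cos\theta$, $y=r\sin\theta$ are used. Given a function $U(u)>0$ and constants $m\ne0$, $a$, put $$\Delta=(1-2a\tau)^2+(m^2U^2-a^2)(4\tau^2-\kappa),\qquad \xi_1=2\sqrt{\frac{m^2U^2-a^2}{(1+\sqrt\Delta)^2-4\tau^2m^2U^2}},$$ $$\xi_2=\int\frac{mU(4+\kappa\xi_1^2)}{4\xi_1^2}\sqrt{\xi_1^2-\frac{m^4U^2U'^2(4+\kappa\xi_1^2)^2}{16\Delta}}\,du,$$ $$\theta(u,t)=\frac tm+\int\frac{(4\tau-a\kappa)\xi_1^2-4a}{4mU\xi_1^2}\sqrt{\xi_1^2-\frac{m^4U^2U'^2(4+\kappa\xi_1^2)^2}{16\Delta}}\,du .$$ Then $\psi_{[U,m,a]}(u,t)=(\xi_1(u),\theta(u,t),\xi_2(u)+a\theta(u,t))$ in cylindrical coordinates is a helicoidal surface of pitch $a$ (invariant under the isometries generated by $\partial_\theta+a\,\partial_z$) with first fundamental form $du^2+U^2dt^2$; it is a rotation surface when $a=0$.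
   Formalization: For n<0 the printed ξ1 and the integrals have the opposite sign to those of ψ_[U,n,0], so the formulas equal ψ_[U,n,0] only for n>0; for n<0 they are shown to give the same surface up to an isometry of the BCV-space and t→−t; all other claims hold for every n≠0. *)

theory Defs
  imports "HOL-Analysis.Analysis"
begin

type_synonym point3 = "real \<times> real \<times> real"

section \<open>Bianchi-Cartan-Vranceanu spaces\<close>

definition bcv_B :: "real \<Rightarrow> point3 \<Rightarrow> real" where
  "bcv_B \<kappa> = (\<lambda>(x, y, z). 1 + \<kappa> / 4 * (x\<^sup>2 + y\<^sup>2))"

definition bcv_space :: "real \<Rightarrow> point3 set" where
  "bcv_space \<kappa> = {p. bcv_B \<kappa> p > 0}"

text \<open>The one-form \<open>dz + \<tau> (y dx - x dy) / B\<close> at a point, evaluated on a tangent vector.\<close>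

definition bcv_form :: "real \<Rightarrow> real \<Rightarrow> point3 \<Rightarrow> point3 \<Rightarrow> real" where
  "bcv_form \<kappa> \<tau> = (\<lambda>(x, y, z) (dx, dy, dz).
     dz + \<tau> * (y * dx - x * dy) / bcv_B \<kappa> (x, y, z))"

definition bcv_metric :: "real \<Rightarrow> real \<Rightarrow> point3 \<Rightarrow> point3 \<Rightarrow> point3 \<Rightarrow> real" where
  "bcv_metric \<kappa> \<tau> p v w =
     (fst v * fst w + fst (snd v) * fst (snd w)) / (bcv_B \<kappa> p)\<^sup>2
       + bcv_form \<kappa> \<tau> p v * bcv_form \<kappa> \<tau> p w"

text \<open>Cylindrical coordinates. The radius is allowed to be negative, as in extended polar
  coordinates: \<open>(-r, \<theta>, z)\<close> and \<open>(r, \<theta> + \<pi>, z)\<close> are the same point.\<close>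

definition cyl :: "real \<Rightarrow> real \<Rightarrow> real \<Rightarrow> point3" where
  "cyl r \<theta> z = (r * cos \<theta>, r * sin \<theta>, z)"

text \<open>Continuous differentiability on an open set of a finite-dimensional space.\<close>

definition C1_map_on :: "'a::euclidean_space set \<Rightarrow> ('a \<Rightarrow> 'b::euclidean_space) \<Rightarrow> bool" where
  "C1_map_on D f \<longleftrightarrow> (\<forall>p\<in>D. f differentiable (at p)) \<and>
     (\<forall>v. continuous_on D (\<lambda>p. frechet_derivative f (at p) v))"

text \<open>Isometries of the space onto itself. The inverse is automatically continuously
  differentiable, since the metric is positive definite.\<close>

definition bcv_isometry :: "real \<Rightarrow> real \<Rightarrow> (point3 \<Rightarrow> point3) \<Rightarrow> bool" where
  "bcv_isometry \<kappa> \<tau> \<Phi> \<longleftrightarrow> bij_betw \<Phi> (bcv_space \<kappa>) (bcv_space \<kappa>) \<and>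
     C1_map_on (bcv_space \<kappa>) \<Phi> \<and>
     (\<forall>p\<in>bcv_space \<kappa>. \<forall>v w.
        bcv_metric \<kappa> \<tau> (\<Phi> p) (frechet_derivative \<Phi> (at p) v) (frechet_derivative \<Phi> (at p) w)
        = bcv_metric \<kappa> \<tau> p v w)"

section \<open>Parametrised surfaces\<close>

definition regular_surface ::
  "real \<Rightarrow> (real \<times> real) set \<Rightarrow> (real \<times> real \<Rightarrow> point3) \<Rightarrow> bool" where
  "regular_surface \<kappa> D X \<longleftrightarrow> X ` D \<subseteq> bcv_space \<kappa> \<and> C1_map_on D X \<and>
     (\<forall>p\<in>D. inj (frechet_derivative X (at p)))"

definition first_form ::
  "real \<Rightarrow> real \<Rightarrow> (real \<times> real \<Rightarrow> point3) \<Rightarrow> real \<times> real \<Rightarrow> real \<times> real \<Rightarrow> real \<times> real \<Rightarrow> real" where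
  "first_form \<kappa> \<tau> X p v w =
     bcv_metric \<kappa> \<tau> (X p) (frechet_derivative X (at p) v) (frechet_derivative X (at p) w)"

text \<open>The first fundamental form is \<open>du\<^sup>2 + U\<^sup>2 dt\<^sup>2\<close>.\<close>

definition has_natural_form ::
  "real \<Rightarrow> real \<Rightarrow> (real \<Rightarrow> real) \<Rightarrow> (real \<times> real) set \<Rightarrow> (real \<times> real \<Rightarrow> point3) \<Rightarrow> bool" where
  "has_natural_form \<kappa> \<tau> U D X \<longleftrightarrow> (\<forall>p\<in>D. \<forall>v w.
     first_form \<kappa> \<tau> X p v w = fst v * fst w + (U (fst p))\<^sup>2 * (snd v * snd w))"

text \<open>Intrinsic isometry of immersed surfaces: a diffeomorphism of the parameter domains that
  pulls back one first fundamental form to the other.\<close>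

definition isometric_surfaces ::
  "real \<Rightarrow> real \<Rightarrow> (real \<times> real) set \<Rightarrow> (real \<times> real \<Rightarrow> point3)
     \<Rightarrow> (real \<times> real) set \<Rightarrow> (real \<times> real \<Rightarrow> point3) \<Rightarrow> bool" where
  "isometric_surfaces \<kappa> \<tau> D X E Y \<longleftrightarrow>
     (\<exists>\<phi>. bij_betw \<phi> D E \<and> C1_map_on D \<phi> \<and>
       (\<forall>p\<in>D. \<forall>v w.
          first_form \<kappa> \<tau> Y (\<phi> p) (frechet_derivative \<phi> (at p) v) (frechet_derivative \<phi> (at p) w)
          = first_form \<kappa> \<tau> X p v w))"

text \<open>The flow at time \<open>s\<close> of the vector field \<open>\<partial>\<^sub>\<theta> + a \<partial>\<^sub>z\<close>.\<close>

definition helicoidal_motion :: "real \<Rightarrow> real \<Rightarrow> point3 \<Rightarrow> point3" where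
  "helicoidal_motion a s =
     (\<lambda>(x, y, z). (x * cos s - y * sin s, x * sin s + y * cos s, z + a * s))"

definition helicoidal_surface ::
  "real \<Rightarrow> real \<Rightarrow> (real \<times> real) set \<Rightarrow> (real \<times> real \<Rightarrow> point3) \<Rightarrow> bool" where
  "helicoidal_surface \<kappa> a D X \<longleftrightarrow> regular_surface \<kappa> D X \<and>
     (\<forall>s. helicoidal_motion a s ` (X ` D) = X ` D)"

abbreviation rotation_surface ::
  "real \<Rightarrow> (real \<times> real) set \<Rightarrow> (real \<times> real \<Rightarrow> point3) \<Rightarrow> bool" where
  "rotation_surface \<kappa> \<equiv> helicoidal_surface \<kappa> 0"

section \<open>The surfaces with natural parameters\<close>

text \<open>An indefinite integral is read as the primitive vanishing at a base point \<open>u0\<close>. The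
  constants of integration enter separately, as the parameters \<open>c\<close> (height) and \<open>d\<close> (angle).\<close>

definition primitive :: "real \<Rightarrow> (real \<Rightarrow> real) \<Rightarrow> real \<Rightarrow> real" where
  "primitive u0 f u = (LBINT x=ereal u0..ereal u. f x)"

definition psi_Delta ::
  "real \<Rightarrow> real \<Rightarrow> (real \<Rightarrow> real) \<Rightarrow> real \<Rightarrow> real \<Rightarrow> real \<Rightarrow> real" where
  "psi_Delta \<kappa> \<tau> U m a u =
     (1 - 2 * a * \<tau>)\<^sup>2 + (m\<^sup>2 * (U u)\<^sup>2 - a\<^sup>2) * (4 * \<tau>\<^sup>2 - \<kappa>)"

definition psi_xi1_quot ::
  "real \<Rightarrow> real \<Rightarrow> (real \<Rightarrow> real) \<Rightarrow> real \<Rightarrow> real \<Rightarrow> real \<Rightarrow> real" where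
  "psi_xi1_quot \<kappa> \<tau> U m a u = (m\<^sup>2 * (U u)\<^sup>2 - a\<^sup>2)
     / ((1 + sqrt (psi_Delta \<kappa> \<tau> U m a u))\<^sup>2 - 4 * \<tau>\<^sup>2 * m\<^sup>2 * (U u)\<^sup>2)"

definition psi_xi1 ::
  "real \<Rightarrow> real \<Rightarrow> (real \<Rightarrow> real) \<Rightarrow> real \<Rightarrow> real \<Rightarrow> real \<Rightarrow> real" where
  "psi_xi1 \<kappa> \<tau> U m a u = 2 * sqrt (psi_xi1_quot \<kappa> \<tau> U m a u)"

definition psi_radicand ::
  "real \<Rightarrow> real \<Rightarrow> (real \<Rightarrow> real) \<Rightarrow> real \<Rightarrow> real \<Rightarrow> real \<Rightarrow> real" where
  "psi_radicand \<kappa> \<tau> U m a u = (psi_xi1 \<kappa> \<tau> U m a u)\<^sup>2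
     - m ^ 4 * (U u)\<^sup>2 * (deriv U u)\<^sup>2 * (4 + \<kappa> * (psi_xi1 \<kappa> \<tau> U m a u)\<^sup>2)\<^sup>2
         / (16 * psi_Delta \<kappa> \<tau> U m a u)"

definition psi_xi2 ::
  "real \<Rightarrow> real \<Rightarrow> (real \<Rightarrow> real) \<Rightarrow> real \<Rightarrow> real \<Rightarrow> real \<Rightarrow> real \<Rightarrow> real \<Rightarrow> real" where
  "psi_xi2 \<kappa> \<tau> U m a u0 c u = c + primitive u0
     (\<lambda>w. m * U w * (4 + \<kappa> * (psi_xi1 \<kappa> \<tau> U m a w)\<^sup>2) / (4 * (psi_xi1 \<kappa> \<tau> U m a w)\<^sup>2)
        * sqrt (psi_radicand \<kappa> \<tau> U m a w)) u"

definition psi_theta ::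
  "real \<Rightarrow> real \<Rightarrow> (real \<Rightarrow> real) \<Rightarrow> real \<Rightarrow> real \<Rightarrow> real \<Rightarrow> real \<Rightarrow> real \<Rightarrow> real \<Rightarrow> real" where
  "psi_theta \<kappa> \<tau> U m a u0 d u t = t / m + d + primitive u0
     (\<lambda>w. ((4 * \<tau> - a * \<kappa>) * (psi_xi1 \<kappa> \<tau> U m a w)\<^sup>2 - 4 * a)
          / (4 * m * U w * (psi_xi1 \<kappa> \<tau> U m a w)\<^sup>2)
        * sqrt (psi_radicand \<kappa> \<tau> U m a w)) u"

definition psi ::
  "real \<Rightarrow> real \<Rightarrow> (real \<Rightarrow> real) \<Rightarrow> real \<Rightarrow> real \<Rightarrow> real \<Rightarrow> real \<Rightarrow> real \<Rightarrow> real \<times> real \<Rightarrow> point3" where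
  "psi \<kappa> \<tau> U m a u0 c d = (\<lambda>(u, t).
     cyl (psi_xi1 \<kappa> \<tau> U m a u) (psi_theta \<kappa> \<tau> U m a u0 d u t)
       (psi_xi2 \<kappa> \<tau> U m a u0 c u + a * psi_theta \<kappa> \<tau> U m a u0 d u t))"

text \<open>The formulas are meaningful over \<open>J\<close> (nonzero denominators, no root of a negative number,
  nonzero radius) and describe points of the space, that is, \<open>B > 0\<close> along the profile.\<close>

definition psi_admissible ::
  "real \<Rightarrow> real \<Rightarrow> (real \<Rightarrow> real) \<Rightarrow> real \<Rightarrow> real \<Rightarrow> real set \<Rightarrow> bool" where
  "psi_admissible \<kappa> \<tau> U m a J \<longleftrightarrow> m \<noteq> 0 \<and> (\<forall>u\<in>J.
     psi_Delta \<kappa> \<tau> U m a u > 0 \<and> psi_xi1_quot \<kappa> \<tau> U m a u > 0 \<and>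
     4 + \<kappa> * (psi_xi1 \<kappa> \<tau> U m a u)\<^sup>2 > 0 \<and> psi_radicand \<kappa> \<tau> U m a u \<ge> 0)"

section \<open>The family of rotation surfaces\<close>

definition rot_Delta :: "real \<Rightarrow> real \<Rightarrow> (real \<Rightarrow> real) \<Rightarrow> real \<Rightarrow> real \<Rightarrow> real" where
  "rot_Delta \<kappa> \<tau> U n u = 1 + (4 * \<tau>\<^sup>2 - \<kappa>) * n\<^sup>2 * (U u)\<^sup>2"

definition rot_denom :: "real \<Rightarrow> real \<Rightarrow> (real \<Rightarrow> real) \<Rightarrow> real \<Rightarrow> real \<Rightarrow> real" where
  "rot_denom \<kappa> \<tau> U n u = 2 * (1 + sqrt (rot_Delta \<kappa> \<tau> U n u)) - \<kappa> * n\<^sup>2 * (U u)\<^sup>2"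

definition rot_xi1 :: "real \<Rightarrow> real \<Rightarrow> (real \<Rightarrow> real) \<Rightarrow> real \<Rightarrow> real \<Rightarrow> real" where
  "rot_xi1 \<kappa> \<tau> U n u = 2 * n * U u / sqrt (rot_denom \<kappa> \<tau> U n u)"

definition rot_xi2 ::
  "real \<Rightarrow> real \<Rightarrow> (real \<Rightarrow> real) \<Rightarrow> real \<Rightarrow> real \<Rightarrow> real \<Rightarrow> real \<Rightarrow> real" where
  "rot_xi2 \<kappa> \<tau> U n u0 c u = c + primitive u0
     (\<lambda>w. sqrt ((1 + sqrt (rot_Delta \<kappa> \<tau> U n w))\<^sup>2 / rot_denom \<kappa> \<tau> U n w
        - n\<^sup>2 * (1 + sqrt (rot_Delta \<kappa> \<tau> U n w)) ^ 4 * (deriv U w)\<^sup>2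
            / (rot_Delta \<kappa> \<tau> U n w * (rot_denom \<kappa> \<tau> U n w)\<^sup>2))) u"

definition rot_theta ::
  "real \<Rightarrow> real \<Rightarrow> (real \<Rightarrow> real) \<Rightarrow> real \<Rightarrow> real \<Rightarrow> real \<Rightarrow> real \<Rightarrow> real \<Rightarrow> real" where
  "rot_theta \<kappa> \<tau> U n u0 d u t = t / n + d + 2 * \<tau> * primitive u0
     (\<lambda>w. sqrt (1 / rot_denom \<kappa> \<tau> U n w
        - n\<^sup>2 * (1 + sqrt (rot_Delta \<kappa> \<tau> U n w))\<^sup>2 * (deriv U w)\<^sup>2
            / (rot_Delta \<kappa> \<tau> U n w * (rot_denom \<kappa> \<tau> U n w)\<^sup>2))) u"

definition rot ::
  "real \<Rightarrow> real \<Rightarrow> (real \<Rightarrow> real) \<Rightarrow> real \<Rightarrow> real \<Rightarrow> real \<Rightarrow> real \<Rightarrow> real \<times> real \<Rightarrow> point3" where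
  "rot \<kappa> \<tau> U n u0 c d = (\<lambda>(u, t).
     cyl (rot_xi1 \<kappa> \<tau> U n u) (rot_theta \<kappa> \<tau> U n u0 d u t) (rot_xi2 \<kappa> \<tau> U n u0 c u))"

end

theory Submission
  imports Defs
begin

text \<open>Put \<open>p = m\<^sup>2 U\<^sup>2\<close>, \<open>q = p - a\<^sup>2\<close>, \<open>s = sqrt \<Delta>\<close>, \<open>D = (1 + s)\<^sup>2 - 4 \<tau>\<^sup>2 p\<close> and \<open>e = 1 + s - 2 a \<tau>\<close>.
  Then \<open>\<xi>\<^sub>1\<^sup>2 = 4 q / D\<close> gives \<open>B = 2 e / D\<close> along the surface, and the derivative of \<open>\<xi>\<^sub>1\<close> turns out
  to be \<open>m\<^sup>2 U U' B\<^sup>2 / (s \<xi>\<^sub>1)\<close>. With these two formulas the first fundamental form of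
  \<open>\<psi>\<close> is seen to be \<open>du\<^sup>2 + U\<^sup>2 dt\<^sup>2\<close>, whatever \<open>m\<close> and \<open>a\<close> are, so that the identity of the parameter
  domain is an isometry between any two of the surfaces. For \<open>a = 0\<close> the three profile functions
  simplify to the stated ones up to the factor \<open>sgn n\<close>; for negative \<open>n\<close> this factor is absorbed by
  a half turn about a horizontal axis.\<close>

section \<open>Primitives on an interval\<close>

text \<open>The integral only sees points strictly between \<open>u0\<close> and \<open>u\<close>,
  in either order, and these lie in the interval \<open>J\<close>. The integrands of
  \<open>psi\<close> and \<open>rot\<close> are compared under admissibility, hence only on
  \<open>J\<close>.\<close>

lemma primitive_cong:
  assumes "is_interval J" "u0 \<in> J" "u \<in> J" and eq: "\<And>w. w \<in> J \<Longrightarrow> f w = g w"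
  shows "primitive u0 f u = primitive u0 g u"
  unfolding primitive_def
proof (rule interval_integral_cong)
  fix x assume "x \<in> einterval (min (ereal u0) (ereal u)) (max (ereal u0) (ereal u))"
  then have "min u0 u < x" "x < max u0 u"
    by (auto simp: einterval_def min_def max_def split: if_splits)
  then have "x \<in> J"
    using assms(1-3) unfolding is_interval_1 by (metis less_imp_le max_def min_def)
  then show "f x = g x" by (rule eq)
qed

lemma primitive_cmult: "primitive u0 (\<lambda>w. k * f w) u = k * primitive u0 f u"
  unfolding primitive_def by (rule interval_lebesgue_integral_mult_right)

lemma has_real_derivative_primitive:
  assumes J: "open J" "is_interval J" "u0 \<in> J" and f: "continuous_on J f" and u: "u \<in> J"
  shows "(primitive u0 f has_real_derivative f u) (at u)"
proof -
  obtain e where e: "e > 0" "cball u e \<subseteq> J"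
    using J(1) u open_contains_cball by blast
  \<comment> \<open>The interval \<open>{a..b}\<close> contains the base point, on whichever side of
    \<open>u\<close> it lies, and has \<open>u\<close> in its interior, so the derivative within it
    is the full derivative.\<close>
  define a b where "a = min u0 (u - e)" and "b = max u0 (u + e)"
  have "u - e \<in> J" "u + e \<in> J"
    using e by (auto simp: dist_real_def subset_iff)
  then have "a \<in> J" "b \<in> J"
    using J(3) unfolding a_def b_def min_def max_def by presburger+
  then have sub: "{a..b} \<subseteq> J"
    by (meson J(2) atLeastAtMost_iff mem_is_interval_1_I subsetI)
  have "a \<le> u0" "u0 \<le> b" "u \<in> {a<..<b}"
    using e by (auto simp: a_def b_def)
  have "((\<lambda>u. LBINT y=u0..u. f y) has_vector_derivative f u) (at u within {a..b})"
    using \<open>a \<le> u0\<close> \<open>u0 \<le> b\<close> \<open>u \<in> {a<..<b}\<close> continuous_on_subset[OF f sub]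
    by (intro interval_integral_FTC2) auto
  moreover have "at u within {a..b} = at u"
    using \<open>u \<in> {a<..<b}\<close> by (intro at_within_Icc_at) auto
  ultimately show ?thesis
    unfolding has_real_derivative_iff_has_vector_derivative primitive_def[abs_def] by simp
qed

section \<open>Helicoidal surfaces over an arbitrary profile and their first fundamental
  form\<close>

text \<open>Radius, angular shift and height are left arbitrary, so that one computation serves both
  \<open>psi\<close> and \<open>rot\<close>; \<open>R\<close> may be negative, as happens for
  \<open>rot\<close> with \<open>n < 0\<close>.\<close>

definition helicoid ::
  "real \<Rightarrow> real \<Rightarrow> (real \<Rightarrow> real) \<Rightarrow> (real \<Rightarrow> real) \<Rightarrow> (real \<Rightarrow> real) \<Rightarrow> real \<times> real \<Rightarrow> point3" where
  "helicoid m a R h Z = (\<lambda>(u, t). cyl (R u) (t / m + h u) (Z u + a * (t / m + h u)))"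

lemma has_derivative_helicoid:
  assumes "(R has_real_derivative R') (at u)" "(h has_real_derivative h') (at u)"
    "(Z has_real_derivative Z') (at u)"
  shows "(helicoid m a R h Z has_derivative (\<lambda>v. let \<theta> = t / m + h u; d\<theta> = snd v / m + h' * fst v in
     (R' * fst v * cos \<theta> - R u * sin \<theta> * d\<theta>, R' * fst v * sin \<theta> + R u * cos \<theta> * d\<theta>,
      Z' * fst v + a * d\<theta>))) (at (u, t))"
proof -
  have *: "((\<lambda>p. f (fst p)) has_derivative (\<lambda>v. fst v * f')) (at (u, t))"
    if "(f has_real_derivative f') (at u)" for f f'
    using that by (intro DERIV_compose_FDERIV has_derivative_fst has_derivative_ident) auto
  note [derivative_intros] = assms[THEN *]
  have "((\<lambda>p. (R (fst p) * cos (snd p / m + h (fst p)), R (fst p) * sin (snd p / m + h (fst p)),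
      Z (fst p) + a * (snd p / m + h (fst p)))) has_derivative
    (\<lambda>v. let \<theta> = t / m + h u; d\<theta> = snd v / m + h' * fst v in
     (R' * fst v * cos \<theta> - R u * sin \<theta> * d\<theta>, R' * fst v * sin \<theta> + R u * cos \<theta> * d\<theta>,
      Z' * fst v + a * d\<theta>))) (at (u, t))"
    unfolding Let_def divide_inverse
    by (rule derivative_eq_intros refl | simp add: algebra_simps)+
  then show ?thesis
    by (simp add: helicoid_def cyl_def case_prod_unfold)
qed

lemma bcv_B_cyl: "bcv_B \<kappa> (cyl r \<theta> z) = 1 + \<kappa> / 4 * r\<^sup>2"
  by (simp add: bcv_B_def cyl_def power_mult_distrib flip: distrib_left)

text \<open>The vectors are the images of \<open>(dr, d\<theta>, dz)\<close> under the differential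
  of \<open>cyl\<close>. As \<open>sin^2 + cos^2 = 1\<close>, the angle drops out: this is the
  metric in cylindrical coordinates.\<close>

lemma bcv_metric_cyl:
  "bcv_metric \<kappa> \<tau> (cyl r \<theta> z)
     (dr * cos \<theta> - r * sin \<theta> * d\<theta>, dr * sin \<theta> + r * cos \<theta> * d\<theta>, dz)
     (dr' * cos \<theta> - r * sin \<theta> * d\<theta>', dr' * sin \<theta> + r * cos \<theta> * d\<theta>', dz')
   = (dr * dr' + r\<^sup>2 * d\<theta> * d\<theta>') / (1 + \<kappa> / 4 * r\<^sup>2)\<^sup>2
     + (dz - \<tau> * r\<^sup>2 / (1 + \<kappa> / 4 * r\<^sup>2) * d\<theta>) * (dz' - \<tau> * r\<^sup>2 / (1 + \<kappa> / 4 * r\<^sup>2) * d\<theta>')"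
proof -
  have form: "bcv_form \<kappa> \<tau> (cyl r \<theta> z)
      (dr * cos \<theta> - r * sin \<theta> * d\<theta>, dr * sin \<theta> + r * cos \<theta> * d\<theta>, dz)
      = dz - \<tau> * r\<^sup>2 / (1 + \<kappa> / 4 * r\<^sup>2) * d\<theta>" for dr d\<theta> dz
  proof -
    have "r * sin \<theta> * (dr * cos \<theta> - r * sin \<theta> * d\<theta>) - r * cos \<theta> * (dr * sin \<theta> + r * cos \<theta> * d\<theta>)
        = - (r\<^sup>2 * d\<theta>) * ((sin \<theta>)\<^sup>2 + (cos \<theta>)\<^sup>2)"
      by algebra
    also have "\<dots> = - (r\<^sup>2 * d\<theta>)" by simp
    finally show ?thesis
      using bcv_B_cyl[of \<kappa> r \<theta> z] by (simp add: bcv_form_def cyl_def)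
  qed
  have "(dr * cos \<theta> - r * sin \<theta> * d\<theta>) * (dr' * cos \<theta> - r * sin \<theta> * d\<theta>')
       + (dr * sin \<theta> + r * cos \<theta> * d\<theta>) * (dr' * sin \<theta> + r * cos \<theta> * d\<theta>')
     = (dr * dr' + r\<^sup>2 * d\<theta> * d\<theta>') * ((sin \<theta>)\<^sup>2 + (cos \<theta>)\<^sup>2)"
    by algebra
  then show ?thesis
    by (simp add: bcv_metric_def form bcv_B_cyl)
qed

text \<open>Here \<open>w\<close> is the value of the one-form \<open>bcv_form\<close> on \<open>\<partial>\<^sub>\<theta> + a \<partial>\<^sub>z\<close>. The assumptions
  \<open>tt\<close> and \<open>ut\<close> say that \<open>g(\<partial>\<^sub>t, \<partial>\<^sub>t) = U\<^sup>2\<close> and \<open>g(\<partial>\<^sub>u, \<partial>\<^sub>t) = 0\<close>; given these, \<open>uu\<close> says that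
  \<open>g(\<partial>\<^sub>u, \<partial>\<^sub>u) = 1\<close>.\<close>

lemma helicoid_natural:
  fixes J :: "real set"
  assumes J: "open J" and m: "m \<noteq> 0" and U: "\<And>u. u \<in> J \<Longrightarrow> U u > 0"
    and R: "\<And>u. u \<in> J \<Longrightarrow> (R has_real_derivative R' u) (at u)" "continuous_on J R'"
    and h: "\<And>u. u \<in> J \<Longrightarrow> (h has_real_derivative h' u) (at u)" "continuous_on J h'"
    and Z: "\<And>u. u \<in> J \<Longrightarrow> (Z has_real_derivative Z' u) (at u)" "continuous_on J Z'"
    and B: "\<And>u. B u = 1 + \<kappa> / 4 * (R u)\<^sup>2" "\<And>u. u \<in> J \<Longrightarrow> B u > 0"
    and w: "\<And>u. w u = a - \<tau> * (R u)\<^sup>2 / B u"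
    and tt: "\<And>u. u \<in> J \<Longrightarrow> (R u)\<^sup>2 / (B u)\<^sup>2 + (w u)\<^sup>2 = m\<^sup>2 * (U u)\<^sup>2"
    and ut: "\<And>u. u \<in> J \<Longrightarrow> m\<^sup>2 * (U u)\<^sup>2 * h' u + w u * Z' u = 0"
    and uu: "\<And>u. u \<in> J \<Longrightarrow> (R' u)\<^sup>2 / (B u)\<^sup>2 + (Z' u)\<^sup>2 + w u * h' u * Z' u = 1"
  shows "helicoidal_surface \<kappa> a (J \<times> UNIV) (helicoid m a R h Z)"
    and "has_natural_form \<kappa> \<tau> U (J \<times> UNIV) (helicoid m a R h Z)"
proof -
  let ?X = "helicoid m a R h Z"
  define F where "F p v = (let \<theta> = snd p / m + h (fst p); d\<theta> = snd v / m + h' (fst p) * fst v in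
     (R' (fst p) * fst v * cos \<theta> - R (fst p) * sin \<theta> * d\<theta>,
      R' (fst p) * fst v * sin \<theta> + R (fst p) * cos \<theta> * d\<theta>,
      Z' (fst p) * fst v + a * d\<theta>))" for p v :: "real \<times> real"
  have deriv: "(?X has_derivative F p) (at p)" if "p \<in> J \<times> UNIV" for p
    using that has_derivative_helicoid[OF R(1) h(1) Z(1), of "fst p" m a "snd p"]
    by (cases p) (auto simp: F_def[abs_def])
  then have fd: "frechet_derivative ?X (at p) = F p" if "p \<in> J \<times> UNIV" for p
    using that frechet_derivative_at by metis
  have form: "first_form \<kappa> \<tau> ?X p v v' = fst v * fst v' + (U (fst p))\<^sup>2 * (snd v * snd v')"
    if p: "p \<in> J \<times> UNIV" for p v v'
  proof -
    obtain u t where [simp]: "p = (u, t)" by (cases p)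
    have u: "u \<in> J" using p by simp
    define x y \<alpha> \<beta> where "x = snd v / m" and "y = snd v' / m"
      and \<alpha>_def: "\<alpha> = x + h' u * fst v" and \<beta>_def: "\<beta> = y + h' u * fst v'"
    have X: "?X p = cyl (R u) (t / m + h u) (Z u + a * (t / m + h u))"
      by (simp add: helicoid_def)
    have Fp: "F p v = (R' u * fst v * cos \<theta> - R u * sin \<theta> * \<alpha>,
        R' u * fst v * sin \<theta> + R u * cos \<theta> * \<alpha>, Z' u * fst v + a * \<alpha>)"
      "F p v' = (R' u * fst v' * cos \<theta> - R u * sin \<theta> * \<beta>,
        R' u * fst v' * sin \<theta> + R u * cos \<theta> * \<beta>, Z' u * fst v' + a * \<beta>)"
      if "\<theta> = t / m + h u" for \<theta>
      by (simp_all add: F_def Let_def that \<alpha>_def \<beta>_def x_def y_def)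
    \<comment> \<open>A variation \<open>d\<close> of the angle also raises the height by
      \<open>a * d\<close>, so the one-form picks up \<open>w u * d\<close>.\<close>
    have "e + a * d - \<tau> * (R u)\<^sup>2 / B u * d = e + w u * d" for d e
      by (simp add: w left_diff_distrib)
    then have "first_form \<kappa> \<tau> ?X p v v' =
        (R' u * fst v * (R' u * fst v') + (R u)\<^sup>2 * \<alpha> * \<beta>) / (B u)\<^sup>2
        + (Z' u * fst v + w u * \<alpha>) * (Z' u * fst v' + w u * \<beta>)"
      unfolding first_form_def fd[OF p] X Fp[OF refl] bcv_metric_cyl B(1) [symmetric] by (simp only:)
    also have "\<dots> = (R' u)\<^sup>2 / (B u)\<^sup>2 * (fst v * fst v') + ((R u)\<^sup>2 / (B u)\<^sup>2 + (w u)\<^sup>2) * (\<alpha> * \<beta>)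
        + (Z' u)\<^sup>2 * (fst v * fst v') + w u * Z' u * (fst v * \<beta> + fst v' * \<alpha>)"
      by (simp add: power2_eq_square algebra_simps add_divide_distrib)
    also have "\<dots> = (R' u)\<^sup>2 / (B u)\<^sup>2 * (fst v * fst v') + m\<^sup>2 * (U u)\<^sup>2 * (\<alpha> * \<beta>)
        + (Z' u)\<^sup>2 * (fst v * fst v') - m\<^sup>2 * (U u)\<^sup>2 * h' u * (fst v * \<beta> + fst v' * \<alpha>)"
    proof -
      have "w u * Z' u = - (m\<^sup>2 * (U u)\<^sup>2 * h' u)" using ut[OF u] by linarith
      then show ?thesis by (simp add: tt[OF u])
    qed
    \<comment> \<open>After inserting \<open>\<alpha> = x + h' u * fst v\<close> and
      \<open>\<beta> = y + h' u * fst v'\<close>, the terms linear in \<open>x\<close> or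
      \<open>y\<close> cancel, which is the orthogonality of the coordinate curves.\<close>
    also have "\<dots> = ((R' u)\<^sup>2 / (B u)\<^sup>2 + (Z' u)\<^sup>2 - h' u * (m\<^sup>2 * (U u)\<^sup>2 * h' u)) * (fst v * fst v')
        + (U u)\<^sup>2 * ((m * x) * (m * y))"
      unfolding \<alpha>_def \<beta>_def by algebra
    also have "h' u * (m\<^sup>2 * (U u)\<^sup>2 * h' u) = - (w u * h' u * Z' u)"
      using ut[OF u] by algebra
    finally show ?thesis
      using uu[OF u] m by (simp add: x_def y_def)
  qed
  then show "has_natural_form \<kappa> \<tau> U (J \<times> UNIV) ?X"
    by (simp add: has_natural_form_def)
  have "inj (F p)" if p: "p \<in> J \<times> UNIV" for p
  proof -
    \<comment> \<open>The first fundamental form is positive definite because \<open>U\<close> does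
      not vanish, so it detects every nonzero vector of the kernel.\<close>
    have "v = 0" if "F p v = 0" for v
    proof -
      have "first_form \<kappa> \<tau> ?X p v v = 0"
        unfolding first_form_def fd[OF p] that
        by (simp add: bcv_metric_def bcv_form_def case_prod_unfold zero_prod_def)
      then have "(fst v)\<^sup>2 + (U (fst p) * snd v)\<^sup>2 = 0"
        by (simp add: form[OF p] power2_eq_square algebra_simps)
      then have "fst v = 0 \<and> U (fst p) * snd v = 0"
        by simp
      moreover have "U (fst p) \<noteq> 0" using U[of "fst p"] p by auto
      ultimately show "v = 0" by (simp add: prod_eq_iff)
    qed
    moreover have "linear (F p)"
      using deriv[OF p] by (rule has_derivative_linear)
    ultimately show ?thesis
      by (simp add: linear_injective_0)
  qed
  moreover have "C1_map_on (J \<times> UNIV) ?X"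
    unfolding C1_map_on_def
  proof (intro conjI ballI allI)
    show "?X differentiable (at p)" if "p \<in> J \<times> UNIV" for p
      using deriv[OF that] by (auto simp: differentiable_def)
    fix v :: "real \<times> real"
    have *: "continuous_on (J \<times> (UNIV :: real set)) (\<lambda>p. f (fst p))" if "continuous_on J f"
      for f :: "real \<Rightarrow> real"
      using that by (rule continuous_on_compose2) (auto intro: continuous_intros)
    have c: "continuous_on J R" "continuous_on J h"
      using R(1) h(1) by (auto intro!: continuous_at_imp_continuous_on DERIV_isCont)
    have "continuous_on (J \<times> UNIV) (\<lambda>p. F p v)"
      unfolding F_def Let_def using m
      by (intro continuous_intros *[OF c(1)] *[OF c(2)] *[OF R(2)] *[OF h(2)] *[OF Z(2)]) auto
    then show "continuous_on (J \<times> UNIV) (\<lambda>p. frechet_derivative ?X (at p) v)"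
      by (rule continuous_on_eq) (simp add: fd)
  qed
  moreover have "?X ` (J \<times> UNIV) \<subseteq> bcv_space \<kappa>"
    using B by (auto simp: bcv_space_def helicoid_def bcv_B_cyl)
  moreover have "helicoidal_motion a s ` (?X ` (J \<times> UNIV)) = ?X ` (J \<times> UNIV)" for s
  proof -
    \<comment> \<open>The flow shifts \<open>t\<close> by \<open>m * s\<close>, and the parameter
      domain \<open>J \<times> UNIV\<close> is invariant under such shifts.\<close>
    have motion: "helicoidal_motion a s (?X (u, t)) = ?X (u, t + m * s)" for u t s
    proof -
      define \<theta> where "\<theta> = t / m + h u"
      have 1: "t / m + h u = \<theta>" "(t + m * s) / m + h u = \<theta> + s"
        using m by (simp_all add: \<theta>_def add_divide_distrib)
      have "?X (u, t) = cyl (R u) \<theta> (Z u + a * \<theta>)"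
        "?X (u, t + m * s) = cyl (R u) (\<theta> + s) (Z u + a * (\<theta> + s))"
        unfolding helicoid_def case_prod_conv 1 by (rule refl)+
      then show ?thesis
        by (simp add: helicoidal_motion_def cyl_def cos_add sin_add algebra_simps)
    qed
    let ?f = "\<lambda>(u :: real, t). (u, t + m * s)"
    have "(u, t) \<in> ?f ` (J \<times> UNIV)" if "u \<in> J" for u t
      using that by (intro image_eqI[of _ _ "(u, t - m * s)"]) auto
    then have "?f ` (J \<times> UNIV) = J \<times> UNIV" by auto
    moreover have "helicoidal_motion a s ` (?X ` (J \<times> UNIV)) = ?X ` (?f ` (J \<times> UNIV))"
      unfolding image_image by (intro image_cong) (auto simp: motion)
    ultimately show ?thesis by simp
  qed
  ultimately show "helicoidal_surface \<kappa> a (J \<times> UNIV) ?X"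
    by (simp add: helicoidal_surface_def regular_surface_def fd)
qed

lemma natural_imp_isometric:
  assumes "open D" "has_natural_form \<kappa> \<tau> U D X" "has_natural_form \<kappa> \<tau> U D Y"
  shows "isometric_surfaces \<kappa> \<tau> D X D Y"
proof -
  have fd: "frechet_derivative (\<lambda>x :: real \<times> real. x) (at p) = (\<lambda>x. x)" for p
    using frechet_derivative_at[OF has_derivative_ident] by metis
  show ?thesis
    unfolding isometric_surfaces_def
    using assms(2,3) by (intro exI[of _ "\<lambda>x. x"]) 
      (auto simp: has_natural_form_def C1_map_on_def fd bij_betw_def)
qed

section \<open>The natural parameters of \<open>psi\<close>\<close>

text \<open>These are the polynomial identities behind the formulas, with \<open>p\<close> standing
  for \<open>m^2 U^2\<close>. In the third, the left side is \<open>s\<close> times the numerator of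
  the derivative of \<open>q / D\<close> with respect to \<open>p\<close>, as the equation for
  \<open>s^2\<close> gives \<open>2 * s * s' = 4 * \<tau>^2 - \<kappa>\<close>.\<close>

lemma psi_algebra:
  fixes p s a \<tau> \<kappa> R :: real
  defines "q \<equiv> p - a\<^sup>2" and "D \<equiv> (1 + s)\<^sup>2 - 4 * \<tau>\<^sup>2 * p" and "e \<equiv> 1 + s - 2 * a * \<tau>"
    and "B \<equiv> 1 + \<kappa> / 4 * R\<^sup>2"
  assumes s: "s\<^sup>2 = (1 - 2 * a * \<tau>)\<^sup>2 + q * (4 * \<tau>\<^sup>2 - \<kappa>)"
    and qD: "q / D \<noteq> 0" and R: "R\<^sup>2 = 4 * (q / D)" and B: "B \<noteq> 0"
  shows "B = 2 * e / D"
    and "R\<^sup>2 / B\<^sup>2 + (a - \<tau> * R\<^sup>2 / B)\<^sup>2 = p"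
    and "s * D - q * ((1 + s) * (4 * \<tau>\<^sup>2 - \<kappa>) - 4 * \<tau>\<^sup>2 * s) = e\<^sup>2"
proof -
  have D: "D \<noteq> 0" and q: "q \<noteq> 0" using qD by auto
  \<comment> \<open>Replacing \<open>s^2\<close> by its value cancels the terms
    \<open>4 * \<tau>^2 * p\<close> and leaves an expression linear in \<open>s\<close>.\<close>
  have "D + \<kappa> * q = 2 * e"
    using s unfolding D_def e_def q_def by algebra
  moreover have "B = (D + \<kappa> * q) / D"
    using D by (simp add: B_def R add_divide_distrib)
  ultimately show B_eq: "B = 2 * e / D" by simp
  then have e: "e \<noteq> 0" using B by auto
  have 1: "R\<^sup>2 / B = 2 * q / e" "R\<^sup>2 / B\<^sup>2 = q * D / e\<^sup>2"
    unfolding R B_eq using D e by (simp_all add: power2_eq_square)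
  \<comment> \<open>Both sides equal \<open>(1 + s)^2 - 4 * a^2 * \<tau>^2\<close>, since
    \<open>e + 4 * a * \<tau> = 1 + s + 2 * a * \<tau>\<close>.\<close>
  have "D + 4 * \<tau>\<^sup>2 * q = e\<^sup>2 + 4 * a * \<tau> * e"
    unfolding D_def e_def q_def by algebra
  then have "q * D + (a * e - 2 * \<tau> * q)\<^sup>2 = p * e\<^sup>2"
    unfolding q_def by algebra
  moreover have "a - \<tau> * (R\<^sup>2 / B) = (a * e - 2 * \<tau> * q) / e"
    unfolding 1(1) using e by (simp add: field_simps)
  ultimately show "R\<^sup>2 / B\<^sup>2 + (a - \<tau> * R\<^sup>2 / B)\<^sup>2 = p"
    using e by (simp add: 1(2) power_divide flip: add_divide_distrib)
  show "s * D - q * ((1 + s) * (4 * \<tau>\<^sup>2 - \<kappa>) - 4 * \<tau>\<^sup>2 * s) = e\<^sup>2"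
    using s unfolding D_def e_def q_def by algebra
qed

lemma psi_admissibleD:
  assumes "psi_admissible \<kappa> \<tau> U m a J" "u \<in> J"
  shows "m \<noteq> 0" "psi_Delta \<kappa> \<tau> U m a u > 0" "psi_xi1_quot \<kappa> \<tau> U m a u > 0"
    "4 + \<kappa> * (psi_xi1 \<kappa> \<tau> U m a u)\<^sup>2 > 0" "psi_radicand \<kappa> \<tau> U m a u \<ge> 0"
    "psi_xi1 \<kappa> \<tau> U m a u > 0"
    "(psi_xi1 \<kappa> \<tau> U m a u)\<^sup>2 = 4 * psi_xi1_quot \<kappa> \<tau> U m a u"
  using assms by (auto simp: psi_admissible_def psi_xi1_def power_mult_distrib)

text \<open>The first equation gives the coordinate field of \<open>t\<close> the length
  \<open>U\<close>. The second identifies the subtracted term of \<open>psi_radicand\<close> as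
  \<open>R^2\<close> times the square of \<open>R' / B\<close>, where \<open>R'\<close> is the
  derivative of the radius.\<close>

lemma psi_profile:
  fixes \<kappa> \<tau> m a u :: real and U :: "real \<Rightarrow> real"
  defines "R \<equiv> psi_xi1 \<kappa> \<tau> U m a u" and "s \<equiv> sqrt (psi_Delta \<kappa> \<tau> U m a u)"
  defines "B \<equiv> 1 + \<kappa> / 4 * R\<^sup>2"
  assumes adm: "psi_admissible \<kappa> \<tau> U m a J" and u: "u \<in> J"
    and U: "(U has_real_derivative U') (at u)"
  shows "R\<^sup>2 / B\<^sup>2 + (a - \<tau> * R\<^sup>2 / B)\<^sup>2 = m\<^sup>2 * (U u)\<^sup>2"
    and "(psi_xi1 \<kappa> \<tau> U m a has_real_derivative m\<^sup>2 * U u * U' * B\<^sup>2 / (s * R)) (at u)"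
proof -
  note A = psi_admissibleD[OF adm u]
  define p q D e where "p = m\<^sup>2 * (U u)\<^sup>2" and "q = p - a\<^sup>2" and "D = (1 + s)\<^sup>2 - 4 * \<tau>\<^sup>2 * p"
    and "e = 1 + s - 2 * a * \<tau>"
  have s: "s > 0" "s\<^sup>2 = psi_Delta \<kappa> \<tau> U m a u" using A(2) by (auto simp: s_def)
  then have s2: "s\<^sup>2 = (1 - 2 * a * \<tau>)\<^sup>2 + q * (4 * \<tau>\<^sup>2 - \<kappa>)"
    by (simp add: psi_Delta_def q_def p_def)
  have Q: "psi_xi1_quot \<kappa> \<tau> U m a u = q / D"
    by (simp add: psi_xi1_quot_def q_def D_def p_def s_def mult.assoc)
  have qD: "q / D > 0" using A(3) Q by simp
  have R: "R\<^sup>2 = 4 * (q / D)" "R > 0" "R = 2 * sqrt (q / D)"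
    using A(6,7) Q by (auto simp: R_def psi_xi1_def)
  have B: "B > 0" using A(4) by (simp add: B_def R_def)
  note alg = psi_algebra[of s a \<tau> p \<kappa> R, folded q_def D_def e_def B_def, OF s2 less_imp_neq[OF qD, symmetric] R(1) less_imp_neq[OF B, symmetric]]
  show "R\<^sup>2 / B\<^sup>2 + (a - \<tau> * R\<^sup>2 / B)\<^sup>2 = m\<^sup>2 * (U u)\<^sup>2"
    using alg(2) by (simp add: p_def)
  define p' s' where "p' = m\<^sup>2 * (2 * U u * U')" and "s' = p' * (4 * \<tau>\<^sup>2 - \<kappa>) / (2 * s)"
  have dp: "((\<lambda>u. m\<^sup>2 * (U u)\<^sup>2) has_real_derivative p') (at u)"
    by (auto intro!: derivative_eq_intros U simp: p'_def)
  have "(psi_Delta \<kappa> \<tau> U m a has_real_derivative p' * (4 * \<tau>\<^sup>2 - \<kappa>)) (at u)"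
    unfolding psi_Delta_def[abs_def] by (auto intro!: derivative_eq_intros U simp: p'_def)
  then have ds: "((\<lambda>u. sqrt (psi_Delta \<kappa> \<tau> U m a u)) has_real_derivative s') (at u)"
    using A(2) by (auto intro!: derivative_eq_intros simp: s'_def s_def field_simps)
  have D: "D \<noteq> 0" using qD by auto
  \<comment> \<open>Abstract \<open>f\<close> and \<open>g\<close> keep the derivative in terms of
    \<open>p'\<close> and \<open>s'\<close>, the shape to which the third identity of
    \<open>psi_algebra\<close> applies.\<close>
  have quot: "((\<lambda>u. (f u - a\<^sup>2) / ((1 + g u)\<^sup>2 - k * f u)) has_real_derivative
      (f' * ((1 + g u)\<^sup>2 - k * f u) - (f u - a\<^sup>2) * (2 * (1 + g u) * g' - k * f'))
        / (((1 + g u)\<^sup>2 - k * f u) * ((1 + g u)\<^sup>2 - k * f u))) (at u)"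
    if "(f has_real_derivative f') (at u)" "(g has_real_derivative g') (at u)"
      "(1 + g u)\<^sup>2 - k * f u \<noteq> 0" for f g f' g' k
    using that by (auto intro!: derivative_eq_intros)
  have "((\<lambda>u. (m\<^sup>2 * (U u)\<^sup>2 - a\<^sup>2) / ((1 + sqrt (psi_Delta \<kappa> \<tau> U m a u))\<^sup>2 - 4 * \<tau>\<^sup>2 * (m\<^sup>2 * (U u)\<^sup>2)))
      has_real_derivative (p' * D - q * (2 * (1 + s) * s' - 4 * \<tau>\<^sup>2 * p')) / (D * D)) (at u)"
    using D unfolding D_def s_def q_def p_def by (intro quot dp ds)
  moreover have "(p' * D - q * (2 * (1 + s) * s' - 4 * \<tau>\<^sup>2 * p')) / (D * D) = p' * B\<^sup>2 / (4 * s)"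
  proof -
    \<comment> \<open>The factor \<open>s\<close> clears the denominator of
      \<open>s'\<close>.\<close>
    have "s * (p' * D - q * (2 * (1 + s) * s' - 4 * \<tau>\<^sup>2 * p'))
        = p' * (s * D - q * ((1 + s) * (4 * \<tau>\<^sup>2 - \<kappa>) - 4 * \<tau>\<^sup>2 * s))"
      using s(1) by (simp add: s'_def field_simps)
    also have "\<dots> = p' * e\<^sup>2"
      using alg(3) by simp
    finally have "p' * D - q * (2 * (1 + s) * s' - 4 * \<tau>\<^sup>2 * p') = p' * e\<^sup>2 / s"
      using s(1) by (simp add: field_simps)
    moreover have "B\<^sup>2 = 4 * e\<^sup>2 / (D * D)"
      using alg(1) by (simp add: power2_eq_square)
    ultimately show ?thesis by simp
  qed
  ultimately have "(psi_xi1_quot \<kappa> \<tau> U m a has_real_derivative p' * B\<^sup>2 / (4 * s)) (at u)"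
    unfolding psi_xi1_quot_def[abs_def] by (simp add: mult.assoc)
  then have "(psi_xi1 \<kappa> \<tau> U m a has_real_derivative
      2 * (p' * B\<^sup>2 / (4 * s) / (2 * sqrt (psi_xi1_quot \<kappa> \<tau> U m a u)))) (at u)"
    unfolding psi_xi1_def[abs_def] using A(3)
    by (auto intro!: derivative_eq_intros simp: field_simps)
  moreover have "2 * (p' * B\<^sup>2 / (4 * s) / (2 * sqrt (psi_xi1_quot \<kappa> \<tau> U m a u)))
      = m\<^sup>2 * U u * U' * B\<^sup>2 / (s * R)"
    by (simp add: p'_def R_def psi_xi1_def ac_simps)
  ultimately show "(psi_xi1 \<kappa> \<tau> U m a has_real_derivative m\<^sup>2 * U u * U' * B\<^sup>2 / (s * R)) (at u)"
    by simp
qed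

text \<open>The sign \<open>\<sigma>\<close> covers both the surfaces \<open>psi\<close> (\<open>\<sigma> = 1\<close>) and \<open>rot\<close> (\<open>\<sigma> = sgn n\<close>): the three
  equations are even in the data of the profile curve.\<close>

lemma signed_psi_natural:
  fixes \<kappa> \<tau> m a u0 c d \<sigma> :: real and U :: "real \<Rightarrow> real"
  assumes J: "open J" "is_interval J" "u0 \<in> J"
    and U_pos: "\<And>u. u \<in> J \<Longrightarrow> U u > 0"
    and U_C1: "U differentiable_on J" "continuous_on J (deriv U)"
    and adm: "psi_admissible \<kappa> \<tau> U m a J" and \<sigma>: "\<sigma>\<^sup>2 = 1"
  defines "Z' \<equiv> \<lambda>w. m * U w * (4 + \<kappa> * (psi_xi1 \<kappa> \<tau> U m a w)\<^sup>2) / (4 * (psi_xi1 \<kappa> \<tau> U m a w)\<^sup>2)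
        * sqrt (psi_radicand \<kappa> \<tau> U m a w)"
    and "h' \<equiv> \<lambda>w. ((4 * \<tau> - a * \<kappa>) * (psi_xi1 \<kappa> \<tau> U m a w)\<^sup>2 - 4 * a)
          / (4 * m * U w * (psi_xi1 \<kappa> \<tau> U m a w)\<^sup>2)
        * sqrt (psi_radicand \<kappa> \<tau> U m a w)"
  defines "X \<equiv> helicoid m a (\<lambda>u. \<sigma> * psi_xi1 \<kappa> \<tau> U m a u)
      (\<lambda>u. d + \<sigma> * primitive u0 h' u) (\<lambda>u. c + \<sigma> * primitive u0 Z' u)"
  shows "helicoidal_surface \<kappa> a (J \<times> UNIV) X" and "has_natural_form \<kappa> \<tau> U (J \<times> UNIV) X"
proof -
  let ?R = "psi_xi1 \<kappa> \<tau> U m a" and ?K = "psi_radicand \<kappa> \<tau> U m a"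
  let ?\<Delta> = "psi_Delta \<kappa> \<tau> U m a"
  note A = psi_admissibleD[OF adm]
  define B w where "B u = 1 + \<kappa> / 4 * (?R u)\<^sup>2" and "w u = a - \<tau> * (?R u)\<^sup>2 / B u" for u
  define R' where "R' u = m\<^sup>2 * U u * deriv U u * (B u)\<^sup>2 / (sqrt (?\<Delta> u) * ?R u)" for u
  have B: "B u > 0" if "u \<in> J" for u using A(4)[OF that] by (simp add: B_def)
  have DU: "(U has_real_derivative deriv U u) (at u)" if "u \<in> J" for u
    using U_C1(1) J(1) that
    by (metis DERIV_deriv_iff_real_differentiable differentiable_on_eq_differentiable_at)
  note prof = psi_profile[OF adm _ DU, folded B_def, folded w_def R'_def]
  have cU: "continuous_on J U"
    using U_C1(1) by (rule differentiable_imp_continuous_on)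
  have c\<Delta>: "continuous_on J ?\<Delta>"
    unfolding psi_Delta_def[abs_def] by (intro continuous_intros cU)
  have cR: "continuous_on J ?R"
    using prof(2) by (auto intro!: continuous_at_imp_continuous_on DERIV_isCont)
  have cB: "continuous_on J B"
    unfolding B_def[abs_def] by (intro continuous_intros cR)
  have nz: "?\<Delta> u \<noteq> 0" "?R u \<noteq> 0" "U u \<noteq> 0" "m \<noteq> 0" if "u \<in> J" for u
    using A(1,2,6)[OF that] U_pos[OF that] by auto
  have cR': "continuous_on J R'"
    unfolding R'_def[abs_def] using nz by (intro continuous_intros cU U_C1(2) cB c\<Delta> cR) auto
  have cK: "continuous_on J ?K"
    unfolding psi_radicand_def[abs_def] using nz by (intro continuous_intros cU U_C1(2) c\<Delta> cR) auto
  have cZ: "continuous_on J Z'" and ch: "continuous_on J h'"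
    unfolding Z'_def h'_def using nz by (intro continuous_intros cU cR cK; auto)+
  have tt: "(?R u)\<^sup>2 / (B u)\<^sup>2 + (w u)\<^sup>2 = m\<^sup>2 * (U u)\<^sup>2" if "u \<in> J" for u
    using prof(1)[OF that that] .
  have Z'_eq: "Z' u = m * U u * B u / (?R u)\<^sup>2 * sqrt (?K u)" if "u \<in> J" for u
    using nz[OF that] by (simp add: Z'_def B_def field_simps)
  \<comment> \<open>The numerator of the angle integrand is \<open>-4 * B u * w u\<close>. Hence
    \<open>m^2 U^2 h'\<close> and \<open>- w Z'\<close> are the same expression, which is the
    orthogonality relation \<open>ut\<close>.\<close>
  have h'_eq: "h' u = - (B u * w u) / (m * U u * (?R u)\<^sup>2) * sqrt (?K u)" if "u \<in> J" for u
  proof -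
    have "B u * w u = a * B u - \<tau> * (?R u)\<^sup>2"
      using B[OF that] by (simp add: w_def right_diff_distrib)
    then have "(4 * \<tau> - a * \<kappa>) * (?R u)\<^sup>2 - 4 * a = 4 * - (B u * w u)"
      by (simp add: B_def algebra_simps)
    then show ?thesis
      by (simp only: h'_def mult.assoc mult_divide_mult_cancel_left zero_neq_numeral)
  qed
  have ut: "m\<^sup>2 * (U u)\<^sup>2 * h' u + w u * Z' u = 0" if "u \<in> J" for u
    using nz[OF that] by (simp add: Z'_eq[OF that] h'_eq[OF that] power2_eq_square)
  have uu: "(R' u)\<^sup>2 / (B u)\<^sup>2 + (Z' u)\<^sup>2 + w u * h' u * Z' u = 1" if u: "u \<in> J" for u
  proof -
    have "(Z' u)\<^sup>2 + w u * h' u * Z' u = (B u)\<^sup>2 / (?R u)^4 * (m\<^sup>2 * (U u)\<^sup>2 - (w u)\<^sup>2) * (sqrt (?K u))\<^sup>2"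
      using nz[OF u] unfolding Z'_eq[OF u] h'_eq[OF u]
      by (simp add: power2_eq_square power4_eq_xxxx field_simps)
    \<comment> \<open>By \<open>tt\<close> the powers of \<open>B\<close> and \<open>R\<close>
      collapse, so that angle and height together contribute \<open>?K u / (?R u)^2\<close>; the
      radicand makes this \<open>1 - (R' u / B u)^2\<close>.\<close>
    also have "m\<^sup>2 * (U u)\<^sup>2 - (w u)\<^sup>2 = (?R u)\<^sup>2 / (B u)\<^sup>2"
      using tt[OF u] by simp
    finally have 1: "(Z' u)\<^sup>2 + w u * h' u * Z' u = ?K u / (?R u)\<^sup>2"
      using nz[OF u] B[OF u] A(5)[OF u] by (simp add: power2_eq_square power4_eq_xxxx)
    have "(4 + \<kappa> * (?R u)\<^sup>2)\<^sup>2 = 16 * (B u)\<^sup>2"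
      by (simp add: B_def power2_eq_square algebra_simps)
    then have "?K u = (?R u)\<^sup>2 - m ^ 4 * (U u)\<^sup>2 * (deriv U u)\<^sup>2 * (B u)\<^sup>2 / ?\<Delta> u"
      by (simp add: psi_radicand_def)
    moreover have "(R' u)\<^sup>2 / (B u)\<^sup>2 = m ^ 4 * (U u)\<^sup>2 * (deriv U u)\<^sup>2 * (B u)\<^sup>2 / ?\<Delta> u / (?R u)\<^sup>2"
    proof -
      have "R' u = m\<^sup>2 * U u * deriv U u * B u / (sqrt (?\<Delta> u) * ?R u) * B u"
        by (simp add: R'_def power2_eq_square)
      then show ?thesis
        using A(2)[OF u] B[OF u] by (simp add: power_divide power_mult_distrib)
    qed
    ultimately show ?thesis
      using 1 nz[OF u] by (simp add: diff_divide_distrib)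
  qed
  have dR: "((\<lambda>u. \<sigma> * ?R u) has_real_derivative \<sigma> * R' u) (at u)" if "u \<in> J" for u
    using prof(2)[OF that that] by (rule DERIV_cmult)
  have dprim: "((\<lambda>u. k + \<sigma> * primitive u0 f u) has_real_derivative \<sigma> * f u) (at u)"
    if "continuous_on J f" "u \<in> J" for u k f
    using DERIV_add[OF DERIV_const DERIV_cmult[OF has_real_derivative_primitive[OF J that]]]
    by (simp only: add_0_left)
  note dh = dprim[OF ch] and dZ = dprim[OF cZ]
  have c\<sigma>: "continuous_on J (\<lambda>u. \<sigma> * R' u)" "continuous_on J (\<lambda>u. \<sigma> * h' u)"
    "continuous_on J (\<lambda>u. \<sigma> * Z' u)"
    by (intro continuous_intros cR' ch cZ)+
  have B\<sigma>: "B u = 1 + \<kappa> / 4 * (\<sigma> * ?R u)\<^sup>2" and w\<sigma>: "w u = a - \<tau> * (\<sigma> * ?R u)\<^sup>2 / B u" for u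
    by (simp_all add: B_def w_def power_mult_distrib \<sigma>)
  have tt\<sigma>: "(\<sigma> * ?R u)\<^sup>2 / (B u)\<^sup>2 + (w u)\<^sup>2 = m\<^sup>2 * (U u)\<^sup>2" if "u \<in> J" for u
    using tt[OF that] by (simp add: power_mult_distrib \<sigma>)
  have ut\<sigma>: "m\<^sup>2 * (U u)\<^sup>2 * (\<sigma> * h' u) + w u * (\<sigma> * Z' u) = 0" if "u \<in> J" for u
    using ut[OF that] by algebra
  have uu\<sigma>: "(\<sigma> * R' u)\<^sup>2 / (B u)\<^sup>2 + (\<sigma> * Z' u)\<^sup>2 + w u * (\<sigma> * h' u) * (\<sigma> * Z' u) = 1"
    if "u \<in> J" for u
  proof -
    have 1: "w u * (\<sigma> * h' u) * (\<sigma> * Z' u) = w u * h' u * Z' u"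
      using \<sigma> by algebra
    show ?thesis
      using uu[OF that] unfolding 1 power_mult_distrib \<sigma> by simp
  qed
  have m: "m \<noteq> 0" using nz(4)[OF J(3)] .
  note nat = helicoid_natural[where \<kappa> = \<kappa> and U = U, OF J(1) m U_pos dR c\<sigma>(1) dh c\<sigma>(2) dZ c\<sigma>(3)
      B\<sigma> B w\<sigma> tt\<sigma> ut\<sigma> uu\<sigma>]
  show "helicoidal_surface \<kappa> a (J \<times> UNIV) X" "has_natural_form \<kappa> \<tau> U (J \<times> UNIV) X"
    unfolding X_def by (rule nat; assumption)+
qed

lemma psi_eq_helicoid:
  "psi \<kappa> \<tau> U m a u0 c d = helicoid m a (psi_xi1 \<kappa> \<tau> U m a)
     (\<lambda>u. d + primitive u0 (\<lambda>w. ((4 * \<tau> - a * \<kappa>) * (psi_xi1 \<kappa> \<tau> U m a w)\<^sup>2 - 4 * a)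
          / (4 * m * U w * (psi_xi1 \<kappa> \<tau> U m a w)\<^sup>2) * sqrt (psi_radicand \<kappa> \<tau> U m a w)) u)
     (psi_xi2 \<kappa> \<tau> U m a u0 c)"
  by (simp add: psi_def helicoid_def psi_theta_def add.assoc)

lemma psi_natural:
  assumes "open J" "is_interval J" "u0 \<in> J" "\<forall>u\<in>J. U u > 0"
    "U differentiable_on J" "continuous_on J (deriv U)" "psi_admissible \<kappa> \<tau> U m a J"
  shows "helicoidal_surface \<kappa> a (J \<times> UNIV) (psi \<kappa> \<tau> U m a u0 c d)"
    and "has_natural_form \<kappa> \<tau> U (J \<times> UNIV) (psi \<kappa> \<tau> U m a u0 c d)"
  using signed_psi_natural[OF assms(1-3) bspec[OF assms(4)] assms(5-7), of 1 d c] by (simp_all add: psi_eq_helicoid psi_xi2_def[abs_def])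

section \<open>Rotation surfaces: the case of pitch zero\<close>

text \<open>For \<open>a = 0\<close> the value of \<open>s^2\<close> turns
  \<open>(1 + s)^2 - 4 * \<tau>^2 * n^2 * U^2\<close> into \<open>rot_denom\<close>. It is positive
  because its quotient with the square \<open>n^2 U^2\<close> is. The last formula is
  \<open>B = 2 * e / D\<close> with \<open>e = 1 + s\<close>.\<close>

lemma rot_denom_pos:
  assumes "psi_admissible \<kappa> \<tau> U n 0 J" "u \<in> J" "U u > 0"
  shows "rot_Delta \<kappa> \<tau> U n u = psi_Delta \<kappa> \<tau> U n 0 u" "rot_Delta \<kappa> \<tau> U n u > 0"
    "rot_denom \<kappa> \<tau> U n u > 0"
    "psi_xi1_quot \<kappa> \<tau> U n 0 u = n\<^sup>2 * (U u)\<^sup>2 / rot_denom \<kappa> \<tau> U n u"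
    "4 + \<kappa> * (psi_xi1 \<kappa> \<tau> U n 0 u)\<^sup>2
      = 8 * (1 + sqrt (rot_Delta \<kappa> \<tau> U n u)) / rot_denom \<kappa> \<tau> U n u"
proof -
  note A = psi_admissibleD[OF assms(1,2)]
  show 1: "rot_Delta \<kappa> \<tau> U n u = psi_Delta \<kappa> \<tau> U n 0 u"
    by (simp add: rot_Delta_def psi_Delta_def)
  then show pos: "rot_Delta \<kappa> \<tau> U n u > 0" using A(2) by simp
  define s where "s = sqrt (rot_Delta \<kappa> \<tau> U n u)"
  have s: "s\<^sup>2 = 1 + (4 * \<tau>\<^sup>2 - \<kappa>) * n\<^sup>2 * (U u)\<^sup>2"
    using pos by (simp add: s_def rot_Delta_def)
  have D: "rot_denom \<kappa> \<tau> U n u = (1 + s)\<^sup>2 - 4 * \<tau>\<^sup>2 * n\<^sup>2 * (U u)\<^sup>2"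
    using s unfolding rot_denom_def s_def[symmetric] by algebra
  then show quot: "psi_xi1_quot \<kappa> \<tau> U n 0 u = n\<^sup>2 * (U u)\<^sup>2 / rot_denom \<kappa> \<tau> U n u"
    by (simp add: psi_xi1_quot_def s_def 1)
  then show "rot_denom \<kappa> \<tau> U n u > 0"
    using A(3) by (metis mult_nonneg_nonneg not_less_iff_gr_or_eq zero_le_power2 divide_nonneg_neg div_by_0 not_less)
  then have "4 + \<kappa> * (psi_xi1 \<kappa> \<tau> U n 0 u)\<^sup>2
      = 4 * (rot_denom \<kappa> \<tau> U n u + \<kappa> * n\<^sup>2 * (U u)\<^sup>2) / rot_denom \<kappa> \<tau> U n u"
    by (simp add: A(7) quot add_divide_distrib)
  then show "4 + \<kappa> * (psi_xi1 \<kappa> \<tau> U n 0 u)\<^sup>2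
      = 8 * (1 + sqrt (rot_Delta \<kappa> \<tau> U n u)) / rot_denom \<kappa> \<tau> U n u"
    by (simp add: rot_denom_def)
qed

text \<open>The radius of \<open>psi\<close> contains the positive root
  \<open>\<bar>n\<bar> * U\<close>, that of \<open>rot\<close> the signed factor
  \<open>n * U\<close>. In the integrands, \<open>psi\<close> carries \<open>n\<close> outside the
  root, as factor or divisor, while \<open>rot\<close> has only the root; both differences amount to
  \<open>sgn n\<close>.\<close>

lemma rot_eq_sgn_psi:
  assumes adm: "psi_admissible \<kappa> \<tau> U n 0 J" and u: "u \<in> J" and U: "U u > 0"
  defines "R \<equiv> psi_xi1 \<kappa> \<tau> U n 0 u" and "K \<equiv> psi_radicand \<kappa> \<tau> U n 0 u"
    and "\<Delta> \<equiv> rot_Delta \<kappa> \<tau> U n u" and "D \<equiv> rot_denom \<kappa> \<tau> U n u"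
  shows "rot_xi1 \<kappa> \<tau> U n u = sgn n * R"
    and "sqrt ((1 + sqrt \<Delta>)\<^sup>2 / D - n\<^sup>2 * (1 + sqrt \<Delta>) ^ 4 * (deriv U u)\<^sup>2 / (\<Delta> * D\<^sup>2))
      = sgn n * (n * U u * (4 + \<kappa> * R\<^sup>2) / (4 * R\<^sup>2) * sqrt K)"
    and "2 * \<tau> * sqrt (1 / D - n\<^sup>2 * (1 + sqrt \<Delta>)\<^sup>2 * (deriv U u)\<^sup>2 / (\<Delta> * D\<^sup>2))
      = sgn n * (((4 * \<tau> - 0 * \<kappa>) * R\<^sup>2 - 4 * 0) / (4 * n * U u * R\<^sup>2) * sqrt K)"
proof -
  note A = psi_admissibleD[OF adm u]
  note F = rot_denom_pos[OF adm u U, folded R_def \<Delta>_def D_def]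
  \<comment> \<open>All radicands are multiples of the one in \<open>rot_theta\<close>:
    \<open>K\<close> is \<open>4 * n^2 * U^2 * E\<close>, and the height radicand is
    \<open>(1 + sqrt \<Delta>)^2 * E\<close>.\<close>
  define E where "E = 1 / D - n\<^sup>2 * (1 + sqrt \<Delta>)\<^sup>2 * (deriv U u)\<^sup>2 / (\<Delta> * D\<^sup>2)"
  have n: "n \<noteq> 0" using A(1) .
  have R2: "R\<^sup>2 = 4 * (n\<^sup>2 * (U u)\<^sup>2) / D" using A(7) F(4) by (simp add: R_def)
  have sgn_abs: "n * sgn n = \<bar>n\<bar>" "n = sgn n * \<bar>n\<bar>" by (simp_all add: abs_sgn sgn_mult_abs)
  show "rot_xi1 \<kappa> \<tau> U n u = sgn n * R"
    unfolding R_def psi_xi1_def F(4) rot_xi1_def D_def[symmetric]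
    using U by (subst (1) sgn_abs(2)) (simp add: real_sqrt_divide real_sqrt_mult)
  have "K = 4 * (n\<^sup>2 * (U u)\<^sup>2) * E"
  proof -
    have "K = R\<^sup>2 - n ^ 4 * (U u)\<^sup>2 * (deriv U u)\<^sup>2 * (8 * (1 + sqrt \<Delta>) / D)\<^sup>2 / (16 * \<Delta>)"
      unfolding K_def psi_radicand_def F(5)[symmetric] R_def by (simp add: F(1))
    also have "\<dots> = 4 * (n\<^sup>2 * (U u)\<^sup>2) * E"
      unfolding R2 E_def using F(2,3) by (simp add: power2_eq_square power4_eq_xxxx field_simps)
    finally show ?thesis .
  qed
  then have K: "sqrt K = 2 * \<bar>n\<bar> * U u * sqrt E"
    using U by (simp add: real_sqrt_mult)
  have "(1 + sqrt \<Delta>)\<^sup>2 / D - n\<^sup>2 * (1 + sqrt \<Delta>) ^ 4 * (deriv U u)\<^sup>2 / (\<Delta> * D\<^sup>2)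
      = (1 + sqrt \<Delta>)\<^sup>2 * E"
    by (simp add: E_def right_diff_distrib power2_eq_square power4_eq_xxxx)
  then have "sqrt ((1 + sqrt \<Delta>)\<^sup>2 / D - n\<^sup>2 * (1 + sqrt \<Delta>) ^ 4 * (deriv U u)\<^sup>2 / (\<Delta> * D\<^sup>2))
      = (1 + sqrt \<Delta>) * sqrt E"
    using F(2) by (simp add: real_sqrt_mult)
  also have "\<dots> = sgn n * (n * U u * (8 * (1 + sqrt \<Delta>) / D) / (4 * R\<^sup>2) * sqrt K)"
  proof -
    \<comment> \<open>Used with \<open>N = \<bar>n\<bar>\<close>: one factor comes from
      \<open>n * sgn n\<close>, the other from \<open>sqrt K\<close>.\<close>
    have sq: "N * (U u * (8 * k / D) / (4 * R\<^sup>2) * (2 * N * U u * x)) = N\<^sup>2 * (U u)\<^sup>2 * (4 * k / (D * R\<^sup>2)) * x"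
      for N k x by (simp add: power2_eq_square)
    have "sgn n * (n * U u * (8 * (1 + sqrt \<Delta>) / D) / (4 * R\<^sup>2) * sqrt K)
        = \<bar>n\<bar> * (U u * (8 * (1 + sqrt \<Delta>) / D) / (4 * R\<^sup>2) * sqrt K)"
      by (simp flip: sgn_abs(1))
    also have "\<dots> = n\<^sup>2 * (U u)\<^sup>2 * (4 * (1 + sqrt \<Delta>) / (D * R\<^sup>2)) * sqrt E"
      unfolding K sq by simp
    finally have 1: "sgn n * (n * U u * (8 * (1 + sqrt \<Delta>) / D) / (4 * R\<^sup>2) * sqrt K)
        = n\<^sup>2 * (U u)\<^sup>2 * (4 * (1 + sqrt \<Delta>) / (D * R\<^sup>2)) * sqrt E" .
    show ?thesis
      unfolding 1 unfolding R2 using n U F(3) by simp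
  qed
  finally show "sqrt ((1 + sqrt \<Delta>)\<^sup>2 / D - n\<^sup>2 * (1 + sqrt \<Delta>) ^ 4 * (deriv U u)\<^sup>2 / (\<Delta> * D\<^sup>2))
      = sgn n * (n * U u * (4 + \<kappa> * R\<^sup>2) / (4 * R\<^sup>2) * sqrt K)"
    by (simp only: F(5))
  have "R\<^sup>2 \<noteq> 0" using A(6) by (simp add: R_def)
  then have "sgn n * (((4 * \<tau> - 0 * \<kappa>) * R\<^sup>2 - 4 * 0) / (4 * n * U u * R\<^sup>2) * sqrt K) = 2 * \<tau> * sqrt E"
    using n U by (simp add: K sgn_if)
  then show "2 * \<tau> * sqrt (1 / D - n\<^sup>2 * (1 + sqrt \<Delta>)\<^sup>2 * (deriv U u)\<^sup>2 / (\<Delta> * D\<^sup>2))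
      = sgn n * (((4 * \<tau> - 0 * \<kappa>) * R\<^sup>2 - 4 * 0) / (4 * n * U u * R\<^sup>2) * sqrt K)"
    by (simp add: E_def)
qed

text \<open>Only the primitives acquire the sign. The constants \<open>c\<close>, \<open>d\<close>
  and the term \<open>t / n\<close> do not, hence the subtractions.\<close>

lemma rot_eq_psi_profile:
  assumes J: "is_interval J" "u0 \<in> J" and U: "\<And>u. u \<in> J \<Longrightarrow> U u > 0"
    and adm: "psi_admissible \<kappa> \<tau> U n 0 J" and u: "u \<in> J"
  shows "rot_xi1 \<kappa> \<tau> U n u = sgn n * psi_xi1 \<kappa> \<tau> U n 0 u"
    and "rot_xi2 \<kappa> \<tau> U n u0 c u = c + sgn n * (psi_xi2 \<kappa> \<tau> U n 0 u0 c u - c)"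
    and "rot_theta \<kappa> \<tau> U n u0 d u t = t / n + d + sgn n * (psi_theta \<kappa> \<tau> U n 0 u0 d u t - t / n - d)"
proof -
  note eq = rot_eq_sgn_psi[OF adm _ U]
  show "rot_xi1 \<kappa> \<tau> U n u = sgn n * psi_xi1 \<kappa> \<tau> U n 0 u"
    by (rule eq[OF u u])
  show "rot_xi2 \<kappa> \<tau> U n u0 c u = c + sgn n * (psi_xi2 \<kappa> \<tau> U n 0 u0 c u - c)"
    unfolding rot_xi2_def psi_xi2_def add_diff_cancel_left' primitive_cmult[symmetric]
    by (intro arg_cong[of _ _ "\<lambda>x. c + x"] primitive_cong[OF J u] eq)
  show "rot_theta \<kappa> \<tau> U n u0 d u t = t / n + d + sgn n * (psi_theta \<kappa> \<tau> U n 0 u0 d u t - t / n - d)"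
    unfolding rot_theta_def psi_theta_def add_diff_cancel_left' add.assoc primitive_cmult[symmetric]
    by (intro arg_cong[of _ _ "\<lambda>x. t / n + (d + x)"] primitive_cong[OF J u] eq)
qed

lemma rot_natural:
  assumes J: "open J" "is_interval J" "u0 \<in> J" and U_pos: "\<forall>u\<in>J. U u > 0"
    and U_C1: "U differentiable_on J" "continuous_on J (deriv U)"
    and adm: "psi_admissible \<kappa> \<tau> U n 0 J"
  shows "rotation_surface \<kappa> (J \<times> UNIV) (rot \<kappa> \<tau> U n u0 c d)"
    and "has_natural_form \<kappa> \<tau> U (J \<times> UNIV) (rot \<kappa> \<tau> U n u0 c d)"
proof -
  let ?X = "helicoid n 0 (\<lambda>u. sgn n * psi_xi1 \<kappa> \<tau> U n 0 u)
      (\<lambda>u. d + sgn n * (psi_theta \<kappa> \<tau> U n 0 u0 d u 0 - d))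
      (\<lambda>u. c + sgn n * (psi_xi2 \<kappa> \<tau> U n 0 u0 c u - c))"
  have n: "(sgn n)\<^sup>2 = 1"
    using psi_admissibleD(1)[OF adm J(3)] by (simp add: sgn_if)
  have X: "rotation_surface \<kappa> (J \<times> UNIV) ?X" "has_natural_form \<kappa> \<tau> U (J \<times> UNIV) ?X"
    using signed_psi_natural[OF J bspec[OF U_pos] U_C1 adm n, of d c]
    by (simp_all add: psi_theta_def psi_xi2_def)
  have eq: "rot \<kappa> \<tau> U n u0 c d p = ?X p" if p_in: "p \<in> J \<times> UNIV" for p
  proof -
    obtain u t where p: "p = (u, t)" "u \<in> J" using p_in by auto
    have "psi_theta \<kappa> \<tau> U n 0 u0 d u t - t / n = psi_theta \<kappa> \<tau> U n 0 u0 d u 0"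
      by (simp add: psi_theta_def)
    then show ?thesis
      using rot_eq_psi_profile[OF J(2,3) bspec[OF U_pos] adm p(2)]
      by (simp add: p(1) rot_def helicoid_def add.assoc)
  qed
  \<comment> \<open>The agreement with \<open>?X\<close> holds only over \<open>J\<close>; openness
    of the domain transfers it to the derivatives.\<close>
  have op: "open (J \<times> (UNIV :: real set))"
    using J(1) by (simp add: open_Times)
  have der: "(rot \<kappa> \<tau> U n u0 c d has_derivative F) (at p) \<longleftrightarrow> (?X has_derivative F) (at p)"
    if "p \<in> J \<times> UNIV" for p F
    using has_derivative_transform_within_open[OF _ op that, of _ F UNIV] eq by (metis (no_types, lifting))
  then have fd: "frechet_derivative (rot \<kappa> \<tau> U n u0 c d) (at p) = frechet_derivative ?X (at p)"
    and df: "rot \<kappa> \<tau> U n u0 c d differentiable (at p) \<longleftrightarrow> ?X differentiable (at p)"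
    if "p \<in> J \<times> UNIV" for p
    using that by (simp_all add: frechet_derivative_def differentiable_def)
  show "has_natural_form \<kappa> \<tau> U (J \<times> UNIV) (rot \<kappa> \<tau> U n u0 c d)"
    using X(2) by (simp add: has_natural_form_def first_form_def fd eq del: split_paired_All)
  have "C1_map_on (J \<times> UNIV) (rot \<kappa> \<tau> U n u0 c d) \<longleftrightarrow> C1_map_on (J \<times> UNIV) ?X"
    unfolding C1_map_on_def by (simp add: fd df cong: continuous_on_cong)
  moreover have "rot \<kappa> \<tau> U n u0 c d ` (J \<times> UNIV) = ?X ` (J \<times> UNIV)"
    using eq by (rule image_cong[OF refl])
  ultimately show "rotation_surface \<kappa> (J \<times> UNIV) (rot \<kappa> \<tau> U n u0 c d)"
    using X(1) by (simp add: helicoidal_surface_def regular_surface_def fd)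
qed

section \<open>Ambient isometries and the surfaces with negative \<open>n\<close>\<close>

lemma bcv_isometry_id: "bcv_isometry \<kappa> \<tau> id"
proof -
  have "frechet_derivative id (at p) = id" for p :: point3
    using frechet_derivative_at[OF has_derivative_id] by metis
  moreover have "id differentiable (at p)" for p :: point3
    using has_derivative_id by (rule differentiableI)
  ultimately show ?thesis
    by (simp add: bcv_isometry_def C1_map_on_def)
qed

text \<open>The half turn about the horizontal line through \<open>(0, 0, k / 2)\<close> whose polar angle
  is \<open>(\<alpha> + \<pi>) / 2\<close>.\<close>

definition half_turn :: "real \<Rightarrow> real \<Rightarrow> point3 \<Rightarrow> point3" where
  "half_turn \<alpha> k = (\<lambda>(x, y, z).
     (- (x * cos \<alpha> + y * sin \<alpha>), y * cos \<alpha> - x * sin \<alpha>, k - z))"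

lemma half_turn_cyl: "half_turn \<alpha> k (cyl r \<theta> z) = cyl (- r) (\<alpha> - \<theta>) (k - z)"
  by (simp add: half_turn_def cyl_def cos_diff sin_diff algebra_simps)

text \<open>The horizontal part is a linear reflection, which preserves \<open>dx^2 + dy^2\<close>
  and \<open>B\<close> and reverses \<open>y dx - x dy\<close>. As \<open>z\<close> is reversed too,
  the one-form only changes sign and its square is preserved. Being an involution, the map is
  bijective.\<close>

lemma bcv_isometry_half_turn: "bcv_isometry \<kappa> \<tau> (half_turn \<alpha> k)"
proof -
  define C S where "C = cos \<alpha>" and "S = sin \<alpha>"
  have CS: "C\<^sup>2 + S\<^sup>2 = 1" by (simp add: C_def S_def)
  let ?\<Phi> = "half_turn \<alpha> k"
  have \<Phi>: "?\<Phi> = (\<lambda>(x, y, z). (- (x * C + y * S), y * C - x * S, k - z))"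
    by (simp add: half_turn_def C_def S_def)
  \<comment> \<open>The map is affine, with linear part \<open>half_turn \<alpha> 0\<close>.\<close>
  have der: "(?\<Phi> has_derivative half_turn \<alpha> 0) (at p)" for p
    unfolding half_turn_def case_prod_unfold by (auto intro!: derivative_eq_intros)
  then have fd: "frechet_derivative ?\<Phi> (at p) = half_turn \<alpha> 0" for p
    using frechet_derivative_at by metis
  have norm: "(- (x * C + y * S))\<^sup>2 + (y * C - x * S)\<^sup>2 = x\<^sup>2 + y\<^sup>2" for x y
    using CS by algebra
  then have B: "bcv_B \<kappa> (?\<Phi> p) = bcv_B \<kappa> p" for p
    unfolding bcv_B_def \<Phi> case_prod_unfold by simp
  have inv: "?\<Phi> (?\<Phi> p) = p" for p
  proof -
    have "- (- (x * C + y * S) * C + (y * C - x * S) * S) = x"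
      "(y * C - x * S) * C - - (x * C + y * S) * S = y" for x y
      using CS by algebra+
    then show ?thesis by (simp add: \<Phi> case_prod_unfold)
  qed
  have form: "bcv_form \<kappa> \<tau> (?\<Phi> p) (half_turn \<alpha> 0 v) = - bcv_form \<kappa> \<tau> p v" for p v
  proof -
    obtain x y z dx dy dz where pv: "p = (x, y, z)" "v = (dx, dy, dz)" by (cases p, cases v) auto
    have "(y * C - x * S) * - (dx * C + dy * S) - - (x * C + y * S) * (dy * C - dx * S) = - (y * dx - x * dy)"
      using CS by algebra
    then have "bcv_form \<kappa> \<tau> (?\<Phi> p) (half_turn \<alpha> 0 v) = - dz + \<tau> * - (y * dx - x * dy) / bcv_B \<kappa> (?\<Phi> p)"
      by (simp add: pv bcv_form_def half_turn_def flip: C_def S_def)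
    then show ?thesis
      unfolding B mult_minus_right minus_divide_left[symmetric] by (simp add: pv bcv_form_def)
  qed
  have "- (dx * C + dy * S) * - (dx' * C + dy' * S) + (dy * C - dx * S) * (dy' * C - dx' * S)
      = dx * dx' + dy * dy'" for dx dy dx' dy'
    using CS by algebra
  then have "bcv_metric \<kappa> \<tau> (?\<Phi> p) (half_turn \<alpha> 0 v) (half_turn \<alpha> 0 w) = bcv_metric \<kappa> \<tau> p v w" for p v w
    unfolding bcv_metric_def form B by (simp add: half_turn_def case_prod_unfold flip: C_def S_def)
  moreover have "bij_betw ?\<Phi> (bcv_space \<kappa>) (bcv_space \<kappa>)"
    by (rule bij_betw_byWitness[where f' = ?\<Phi>]) (auto simp: inv B bcv_space_def)
  ultimately show ?thesis
    using differentiableI[OF der] by (simp add: bcv_isometry_def C1_map_on_def fd)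
qed

lemma rot_congruent_psi:
  assumes J: "is_interval J" "u0 \<in> J" and U: "\<forall>u\<in>J. U u > 0"
    and adm: "psi_admissible \<kappa> \<tau> U n 0 J"
  shows "\<exists>\<Phi>. bcv_isometry \<kappa> \<tau> \<Phi> \<and> (n > 0 \<longrightarrow> \<Phi> = id) \<and>
    (\<forall>u\<in>J. \<forall>t. rot \<kappa> \<tau> U n u0 c d (u, t) = \<Phi> (psi \<kappa> \<tau> U n 0 u0 c d (u, sgn n * t)))"
proof (cases "n > 0")
  case True
  then show ?thesis
    using rot_eq_psi_profile[OF J bspec[OF U] adm]
    by (intro exI[of _ id]) (simp add: bcv_isometry_id rot_def psi_def)
next
  case False
  with psi_admissibleD(1)[OF adm J(2)] have n: "n < 0" by simp
  \<comment> \<open>With \<open>sgn n = -1\<close> the height becomes \<open>2 * c\<close> minus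
    that of \<open>psi\<close>. The angle becomes \<open>2 * d\<close> minus that of
    \<open>psi\<close> at \<open>- t\<close>, because the term \<open>t / n\<close> kept its
    sign.\<close>
  have "rot \<kappa> \<tau> U n u0 c d (u, t) = half_turn (2 * d) (2 * c) (psi \<kappa> \<tau> U n 0 u0 c d (u, - t))"
    if "u \<in> J" for u t
  proof -
    have "psi_theta \<kappa> \<tau> U n 0 u0 d u (- t) = psi_theta \<kappa> \<tau> U n 0 u0 d u t - 2 * (t / n)"
      by (simp add: psi_theta_def)
    then show ?thesis
      using rot_eq_psi_profile[OF J bspec[OF U] adm that] n
      by (simp add: rot_def psi_def half_turn_cyl add_diff_eq diff_diff_eq2)
  qed
  then show ?thesis
    using n by (intro exI[of _ "half_turn (2 * d) (2 * c)"]) (simp add: bcv_isometry_half_turn)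
qed

section \<open>The formulas in the special geometries\<close>

text \<open>Here \<open>\<Delta> = 1\<close> and \<open>D = 4 * G\<close>, so no nested root
  survives.\<close>

lemma rot_S3:
  assumes \<kappa>: "\<kappa> = 4 * \<tau>\<^sup>2" and D: "rot_denom \<kappa> \<tau> U n u > 0"
  defines "\<Delta> \<equiv> rot_Delta \<kappa> \<tau> U n u" and "D \<equiv> rot_denom \<kappa> \<tau> U n u"
    and "G \<equiv> 1 - \<tau>\<^sup>2 * n\<^sup>2 * (U u)\<^sup>2"
  shows "rot_xi1 \<kappa> \<tau> U n u = n * U u / sqrt G"
    and "sqrt ((1 + sqrt \<Delta>)\<^sup>2 / D - n\<^sup>2 * (1 + sqrt \<Delta>) ^ 4 * (deriv U u)\<^sup>2 / (\<Delta> * D\<^sup>2))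
      = sqrt (1 - n\<^sup>2 * (\<tau>\<^sup>2 * (U u)\<^sup>2 + (deriv U u)\<^sup>2)) / G"
    and "2 * sqrt (1 / D - n\<^sup>2 * (1 + sqrt \<Delta>)\<^sup>2 * (deriv U u)\<^sup>2 / (\<Delta> * D\<^sup>2))
      = sqrt (1 - n\<^sup>2 * (\<tau>\<^sup>2 * (U u)\<^sup>2 + (deriv U u)\<^sup>2)) / G"
proof -
  have \<Delta>: "\<Delta> = 1" by (simp add: \<Delta>_def rot_Delta_def \<kappa>)
  have D4: "D = 4 * G"
    unfolding D_def rot_denom_def \<Delta>_def[symmetric] \<Delta> by (simp add: G_def \<kappa>)
  have G: "G > 0" using D D4 by (simp add: D_def)
  have num: "1 - n\<^sup>2 * (\<tau>\<^sup>2 * (U u)\<^sup>2 + (deriv U u)\<^sup>2) = G - n\<^sup>2 * (deriv U u)\<^sup>2"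
    by (simp add: G_def algebra_simps)
  show "rot_xi1 \<kappa> \<tau> U n u = n * U u / sqrt G"
    using D4 by (simp add: rot_xi1_def real_sqrt_mult flip: D_def)
  have "(1 + sqrt \<Delta>)\<^sup>2 / D - n\<^sup>2 * (1 + sqrt \<Delta>) ^ 4 * (deriv U u)\<^sup>2 / (\<Delta> * D\<^sup>2)
      = (G - n\<^sup>2 * (deriv U u)\<^sup>2) / G\<^sup>2"
    using G by (simp add: \<Delta> D4 power2_eq_square field_simps)
  then show "sqrt ((1 + sqrt \<Delta>)\<^sup>2 / D - n\<^sup>2 * (1 + sqrt \<Delta>) ^ 4 * (deriv U u)\<^sup>2 / (\<Delta> * D\<^sup>2))
      = sqrt (1 - n\<^sup>2 * (\<tau>\<^sup>2 * (U u)\<^sup>2 + (deriv U u)\<^sup>2)) / G"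
    using G by (simp add: num real_sqrt_divide)
  have "1 / D - n\<^sup>2 * (1 + sqrt \<Delta>)\<^sup>2 * (deriv U u)\<^sup>2 / (\<Delta> * D\<^sup>2)
      = (G - n\<^sup>2 * (deriv U u)\<^sup>2) / (2 * G)\<^sup>2"
    using G by (simp add: \<Delta> D4 power2_eq_square field_simps)
  then show "2 * sqrt (1 / D - n\<^sup>2 * (1 + sqrt \<Delta>)\<^sup>2 * (deriv U u)\<^sup>2 / (\<Delta> * D\<^sup>2))
      = sqrt (1 - n\<^sup>2 * (\<tau>\<^sup>2 * (U u)\<^sup>2 + (deriv U u)\<^sup>2)) / G"
    using G unfolding num by (simp only: real_sqrt_divide real_sqrt_abs)
qed

text \<open>Now \<open>\<kappa> * n^2 * U^2 = 1 - \<Delta>\<close>, which makes \<open>D\<close> the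
  perfect square \<open>(1 + sqrt \<Delta>)^2\<close>.\<close>

lemma rot_product:
  assumes \<tau>: "\<tau> = 0" and \<Delta>: "rot_Delta \<kappa> \<tau> U n u > 0"
  defines "\<Delta> \<equiv> rot_Delta \<kappa> \<tau> U n u" and "D \<equiv> rot_denom \<kappa> \<tau> U n u"
  shows "rot_xi1 \<kappa> \<tau> U n u = 2 * n * U u / (1 + sqrt (1 - \<kappa> * n\<^sup>2 * (U u)\<^sup>2))"
    and "(1 + sqrt \<Delta>)\<^sup>2 / D - n\<^sup>2 * (1 + sqrt \<Delta>) ^ 4 * (deriv U u)\<^sup>2 / (\<Delta> * D\<^sup>2)
      = (1 - n\<^sup>2 * (\<kappa> * (U u)\<^sup>2 + (deriv U u)\<^sup>2)) / (1 - \<kappa> * n\<^sup>2 * (U u)\<^sup>2)"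
proof -
  have pos: "\<Delta> > 0" using \<Delta> by (simp add: \<Delta>_def)
  have \<Delta>_eq: "\<Delta> = 1 - \<kappa> * n\<^sup>2 * (U u)\<^sup>2" by (simp add: \<Delta>_def rot_Delta_def \<tau>)
  have "D = 1 + 2 * sqrt \<Delta> + \<Delta>"
    using \<Delta>_eq by (simp add: D_def rot_denom_def flip: \<Delta>_def)
  also have "\<dots> = (1 + sqrt \<Delta>)\<^sup>2" using pos by (simp add: power2_sum)
  finally have D: "D = (1 + sqrt \<Delta>)\<^sup>2" .
  have k: "1 + sqrt \<Delta> > 0" using pos by (simp add: add_pos_pos)
  then show "rot_xi1 \<kappa> \<tau> U n u = 2 * n * U u / (1 + sqrt (1 - \<kappa> * n\<^sup>2 * (U u)\<^sup>2))"
    using D by (simp add: rot_xi1_def flip: D_def \<Delta>_eq)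
  have "(1 + sqrt \<Delta>)\<^sup>2 / D - n\<^sup>2 * (1 + sqrt \<Delta>) ^ 4 * (deriv U u)\<^sup>2 / (\<Delta> * D\<^sup>2)
      = 1 - n\<^sup>2 * (deriv U u)\<^sup>2 / \<Delta>"
    using k by (simp add: D)
  also have "\<dots> = (\<Delta> - n\<^sup>2 * (deriv U u)\<^sup>2) / \<Delta>"
    using pos by (simp add: diff_divide_distrib)
  also have "\<Delta> - n\<^sup>2 * (deriv U u)\<^sup>2 = 1 - n\<^sup>2 * (\<kappa> * (U u)\<^sup>2 + (deriv U u)\<^sup>2)"
    by (simp add: \<Delta>_eq algebra_simps)
  finally show "(1 + sqrt \<Delta>)\<^sup>2 / D - n\<^sup>2 * (1 + sqrt \<Delta>) ^ 4 * (deriv U u)\<^sup>2 / (\<Delta> * D\<^sup>2)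
      = (1 - n\<^sup>2 * (\<kappa> * (U u)\<^sup>2 + (deriv U u)\<^sup>2)) / (1 - \<kappa> * n\<^sup>2 * (U u)\<^sup>2)"
    by (simp only: \<Delta>_eq)
qed

text \<open>With \<open>\<kappa> = 0\<close> the denominator reduces to
  \<open>D = 2 * (1 + sqrt \<Delta>)\<close>.\<close>

lemma rot_Heisenberg:
  assumes \<kappa>: "\<kappa> = 0" and \<Delta>: "rot_Delta \<kappa> \<tau> U n u > 0"
  defines "\<Delta> \<equiv> rot_Delta \<kappa> \<tau> U n u" and "D \<equiv> rot_denom \<kappa> \<tau> U n u"
  shows "rot_xi1 \<kappa> \<tau> U n u = sqrt 2 * n * U u / sqrt (1 + sqrt \<Delta>)"
    and "sqrt ((1 + sqrt \<Delta>)\<^sup>2 / D - n\<^sup>2 * (1 + sqrt \<Delta>) ^ 4 * (deriv U u)\<^sup>2 / (\<Delta> * D\<^sup>2))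
      = (1 + sqrt \<Delta>) / 2 * sqrt (2 / (1 + sqrt \<Delta>) - n\<^sup>2 * (deriv U u)\<^sup>2 / \<Delta>)"
    and "2 * sqrt (1 / D - n\<^sup>2 * (1 + sqrt \<Delta>)\<^sup>2 * (deriv U u)\<^sup>2 / (\<Delta> * D\<^sup>2))
      = sqrt (2 / (1 + sqrt \<Delta>) - n\<^sup>2 * (deriv U u)\<^sup>2 / \<Delta>)"
proof -
  define k where "k = 1 + sqrt \<Delta>"
  have pos: "\<Delta> > 0" using \<Delta> by (simp add: \<Delta>_def)
  then have k: "k > 0" by (simp add: k_def add_pos_pos)
  have D: "D = 2 * k" by (simp add: D_def rot_denom_def \<kappa> k_def \<Delta>_def)
  have "2 = sqrt 2 * sqrt (2 :: real)" by simp
  then show "rot_xi1 \<kappa> \<tau> U n u = sqrt 2 * n * U u / sqrt (1 + sqrt \<Delta>)"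
    unfolding rot_xi1_def D_def[symmetric] D k_def[symmetric]
    using k by (simp add: real_sqrt_mult field_simps)
  have eq: "1 / D - n\<^sup>2 * k\<^sup>2 * (deriv U u)\<^sup>2 / (\<Delta> * D\<^sup>2) = (2 / k - n\<^sup>2 * (deriv U u)\<^sup>2 / \<Delta>) / 2\<^sup>2"
    using k pos by (simp add: D power2_eq_square field_simps)
  then show "2 * sqrt (1 / D - n\<^sup>2 * (1 + sqrt \<Delta>)\<^sup>2 * (deriv U u)\<^sup>2 / (\<Delta> * D\<^sup>2))
      = sqrt (2 / (1 + sqrt \<Delta>) - n\<^sup>2 * (deriv U u)\<^sup>2 / \<Delta>)"
    unfolding k_def[symmetric] by (simp only: real_sqrt_divide real_sqrt_abs)
  have "k\<^sup>2 / D - n\<^sup>2 * k ^ 4 * (deriv U u)\<^sup>2 / (\<Delta> * D\<^sup>2)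
      = k\<^sup>2 * (1 / D - n\<^sup>2 * k\<^sup>2 * (deriv U u)\<^sup>2 / (\<Delta> * D\<^sup>2))"
    by (simp add: right_diff_distrib power2_eq_square power4_eq_xxxx)
  also have "\<dots> = (k / 2)\<^sup>2 * (2 / k - n\<^sup>2 * (deriv U u)\<^sup>2 / \<Delta>)"
    unfolding eq by (simp add: power_divide)
  finally show "sqrt ((1 + sqrt \<Delta>)\<^sup>2 / D - n\<^sup>2 * (1 + sqrt \<Delta>) ^ 4 * (deriv U u)\<^sup>2 / (\<Delta> * D\<^sup>2))
      = (1 + sqrt \<Delta>) / 2 * sqrt (2 / (1 + sqrt \<Delta>) - n\<^sup>2 * (deriv U u)\<^sup>2 / \<Delta>)"
    using k unfolding k_def[symmetric] by (simp only: real_sqrt_mult real_sqrt_abs)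
qed

theorem corollary3p4:
  fixes \<kappa> \<tau> n u0 c d :: real and U :: "real \<Rightarrow> real" and J :: "real set"
  assumes J: "open J" "is_interval J" "u0 \<in> J"
    and U_pos: "\<forall>u\<in>J. U u > 0"
    and U_C1: "U differentiable_on J" "continuous_on J (deriv U)"
    and n: "n \<noteq> 0" "psi_admissible \<kappa> \<tau> U n 0 J"
  shows "
    \<comment> \<open>the surfaces are given by the formulas; for negative \<open>n\<close> the root of
        \<open>n\<^sup>2 U\<^sup>2\<close> is not \<open>n U\<close>, and they agree up to an ambient isometry and \<open>t \<mapsto> -t\<close>\<close>
    (n > 0 \<longrightarrow> (\<forall>u\<in>J. psi_xi1 \<kappa> \<tau> U n 0 u = rot_xi1 \<kappa> \<tau> U n u \<and>
        psi_xi2 \<kappa> \<tau> U n 0 u0 c u = rot_xi2 \<kappa> \<tau> U n u0 c u \<and>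
        (\<forall>t. psi_theta \<kappa> \<tau> U n 0 u0 d u t = rot_theta \<kappa> \<tau> U n u0 d u t))) \<and>
    (\<exists>\<Phi>. bcv_isometry \<kappa> \<tau> \<Phi> \<and> (n > 0 \<longrightarrow> \<Phi> = id) \<and>
        (\<forall>u\<in>J. \<forall>t. rot \<kappa> \<tau> U n u0 c d (u, t) = \<Phi> (psi \<kappa> \<tau> U n 0 u0 c d (u, sgn n * t)))) \<and>
    \<comment> \<open>they are rotation surfaces with the prescribed first fundamental form\<close>
    (rotation_surface \<kappa> (J \<times> UNIV) (psi \<kappa> \<tau> U n 0 u0 c d)) \<and>
    (has_natural_form \<kappa> \<tau> U (J \<times> UNIV) (psi \<kappa> \<tau> U n 0 u0 c d)) \<and>
    (rotation_surface \<kappa> (J \<times> UNIV) (rot \<kappa> \<tau> U n u0 c d)) \<and>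
    (has_natural_form \<kappa> \<tau> U (J \<times> UNIV) (rot \<kappa> \<tau> U n u0 c d)) \<and>
    \<comment> \<open>they are isometric to each other\<close>
    (\<forall>n' u0' c' d'. u0' \<in> J \<and> psi_admissible \<kappa> \<tau> U n' 0 J \<longrightarrow>
        isometric_surfaces \<kappa> \<tau> (J \<times> UNIV) (rot \<kappa> \<tau> U n u0 c d)
          (J \<times> UNIV) (rot \<kappa> \<tau> U n' u0' c' d')) \<and>
    \<comment> \<open>and to the helicoidal surfaces with the same \<open>U\<close>\<close>
    (\<forall>m a u0' c' d'. u0' \<in> J \<and> psi_admissible \<kappa> \<tau> U m a J \<longrightarrow>
        helicoidal_surface \<kappa> a (J \<times> UNIV) (psi \<kappa> \<tau> U m a u0' c' d') \<and>
        has_natural_form \<kappa> \<tau> U (J \<times> UNIV) (psi \<kappa> \<tau> U m a u0' c' d') \<and>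
        isometric_surfaces \<kappa> \<tau> (J \<times> UNIV) (rot \<kappa> \<tau> U n u0 c d)
          (J \<times> UNIV) (psi \<kappa> \<tau> U m a u0' c' d')) \<and>
    \<comment> \<open>case (1)\<close>
    (\<kappa> = 4 * \<tau>\<^sup>2 \<and> \<kappa> \<noteq> 0 \<longrightarrow> (\<forall>u\<in>J.
        rot_xi1 \<kappa> \<tau> U n u = n * U u / sqrt (1 - \<tau>\<^sup>2 * n\<^sup>2 * (U u)\<^sup>2) \<and>
        rot_xi2 \<kappa> \<tau> U n u0 c u = c + primitive u0
          (\<lambda>w. sqrt (1 - n\<^sup>2 * (\<tau>\<^sup>2 * (U w)\<^sup>2 + (deriv U w)\<^sup>2)) / (1 - \<tau>\<^sup>2 * n\<^sup>2 * (U w)\<^sup>2)) u \<and>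
        (\<forall>t. rot_theta \<kappa> \<tau> U n u0 d u t = t / n + d + \<tau> * primitive u0
          (\<lambda>w. sqrt (1 - n\<^sup>2 * (\<tau>\<^sup>2 * (U w)\<^sup>2 + (deriv U w)\<^sup>2)) / (1 - \<tau>\<^sup>2 * n\<^sup>2 * (U w)\<^sup>2)) u))) \<and>
    \<comment> \<open>case (2)\<close>
    (\<tau> = 0 \<longrightarrow> (\<forall>u\<in>J.
        rot_xi1 \<kappa> \<tau> U n u = 2 * n * U u / (1 + sqrt (1 - \<kappa> * n\<^sup>2 * (U u)\<^sup>2)) \<and>
        rot_xi2 \<kappa> \<tau> U n u0 c u = c + primitive u0
          (\<lambda>w. sqrt ((1 - n\<^sup>2 * (\<kappa> * (U w)\<^sup>2 + (deriv U w)\<^sup>2)) / (1 - \<kappa> * n\<^sup>2 * (U w)\<^sup>2))) u \<and>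
        (\<forall>t. rot_theta \<kappa> \<tau> U n u0 d u t = t / n + d))) \<and>
    \<comment> \<open>case (3)\<close>
    (\<kappa> = 0 \<and> \<tau> \<noteq> 0 \<longrightarrow> (\<forall>u\<in>J. rot_Delta \<kappa> \<tau> U n u = 1 + 4 * \<tau>\<^sup>2 * n\<^sup>2 * (U u)\<^sup>2 \<and>
        rot_xi1 \<kappa> \<tau> U n u = sqrt 2 * n * U u / sqrt (1 + sqrt (rot_Delta \<kappa> \<tau> U n u)) \<and>
        rot_xi2 \<kappa> \<tau> U n u0 c u = c + primitive u0
          (\<lambda>w. (1 + sqrt (rot_Delta \<kappa> \<tau> U n w)) / 2
             * sqrt (2 / (1 + sqrt (rot_Delta \<kappa> \<tau> U n w))
                 - n\<^sup>2 * (deriv U w)\<^sup>2 / rot_Delta \<kappa> \<tau> U n w)) u \<and>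
        (\<forall>t. rot_theta \<kappa> \<tau> U n u0 d u t = t / n + d + \<tau> * primitive u0
          (\<lambda>w. sqrt (2 / (1 + sqrt (rot_Delta \<kappa> \<tau> U n w))
                 - n\<^sup>2 * (deriv U w)\<^sup>2 / rot_Delta \<kappa> \<tau> U n w)) u))) \<and>
    \<comment> \<open>case (4)\<close>
    (\<kappa> \<noteq> 0 \<and> \<tau> \<noteq> 0 \<longrightarrow>
        rotation_surface \<kappa> (J \<times> UNIV) (rot \<kappa> \<tau> U n u0 c d) \<and>
        has_natural_form \<kappa> \<tau> U (J \<times> UNIV) (rot \<kappa> \<tau> U n u0 c d))"
proof -
  have op: "open (J \<times> (UNIV :: real set))" using J(1) by (simp add: open_Times)
  note F = rot_denom_pos[OF n(2) _ bspec[OF U_pos]]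
  note rot = rot_natural[OF J(1,2) _ U_pos U_C1]
  note psi = psi_natural[OF J(1,2) _ U_pos U_C1]
  note pc = primitive_cong[OF J(2,3)]
  have formulas: "psi_xi1 \<kappa> \<tau> U n 0 u = rot_xi1 \<kappa> \<tau> U n u"
    "psi_xi2 \<kappa> \<tau> U n 0 u0 c u = rot_xi2 \<kappa> \<tau> U n u0 c u"
    "psi_theta \<kappa> \<tau> U n 0 u0 d u t = rot_theta \<kappa> \<tau> U n u0 d u t"
    if "n > 0" "u \<in> J" for u t
    using rot_eq_psi_profile[OF J(2,3) bspec[OF U_pos] n(2) that(2)] that(1) by simp_all
  have S3: "rot_xi1 \<kappa> \<tau> U n u = n * U u / sqrt (1 - \<tau>\<^sup>2 * n\<^sup>2 * (U u)\<^sup>2)"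
    "rot_xi2 \<kappa> \<tau> U n u0 c u = c + primitive u0
      (\<lambda>w. sqrt (1 - n\<^sup>2 * (\<tau>\<^sup>2 * (U w)\<^sup>2 + (deriv U w)\<^sup>2)) / (1 - \<tau>\<^sup>2 * n\<^sup>2 * (U w)\<^sup>2)) u"
    "rot_theta \<kappa> \<tau> U n u0 d u t = t / n + d + \<tau> * primitive u0
      (\<lambda>w. sqrt (1 - n\<^sup>2 * (\<tau>\<^sup>2 * (U w)\<^sup>2 + (deriv U w)\<^sup>2)) / (1 - \<tau>\<^sup>2 * n\<^sup>2 * (U w)\<^sup>2)) u"
    if \<kappa>: "\<kappa> = 4 * \<tau>\<^sup>2" and u: "u \<in> J" for u t
  proof -
    note S = rot_S3[OF \<kappa> F(3)]
    show "rot_xi1 \<kappa> \<tau> U n u = n * U u / sqrt (1 - \<tau>\<^sup>2 * n\<^sup>2 * (U u)\<^sup>2)"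
      by (rule S(1)[OF u u])
    show "rot_xi2 \<kappa> \<tau> U n u0 c u = c + primitive u0
      (\<lambda>w. sqrt (1 - n\<^sup>2 * (\<tau>\<^sup>2 * (U w)\<^sup>2 + (deriv U w)\<^sup>2)) / (1 - \<tau>\<^sup>2 * n\<^sup>2 * (U w)\<^sup>2)) u"
      unfolding rot_xi2_def by (intro arg_cong[of _ _ "\<lambda>x. c + x"] pc u S(2))
    show "rot_theta \<kappa> \<tau> U n u0 d u t = t / n + d + \<tau> * primitive u0
      (\<lambda>w. sqrt (1 - n\<^sup>2 * (\<tau>\<^sup>2 * (U w)\<^sup>2 + (deriv U w)\<^sup>2)) / (1 - \<tau>\<^sup>2 * n\<^sup>2 * (U w)\<^sup>2)) u"
      \<comment> \<open>The factor 2 of \<open>2 * \<tau>\<close> is moved under the integral, where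
        \<open>rot_S3\<close> absorbs it.\<close>
      unfolding rot_theta_def mult.commute[of 2 \<tau>] mult.assoc[of \<tau> 2] primitive_cmult[symmetric, of 2]
      by (intro arg_cong[of _ _ "\<lambda>x. t / n + d + \<tau> * x"] pc u S(3))
  qed
  have product: "rot_xi1 \<kappa> \<tau> U n u = 2 * n * U u / (1 + sqrt (1 - \<kappa> * n\<^sup>2 * (U u)\<^sup>2))"
    "rot_xi2 \<kappa> \<tau> U n u0 c u = c + primitive u0
      (\<lambda>w. sqrt ((1 - n\<^sup>2 * (\<kappa> * (U w)\<^sup>2 + (deriv U w)\<^sup>2)) / (1 - \<kappa> * n\<^sup>2 * (U w)\<^sup>2))) u"
    "rot_theta \<kappa> \<tau> U n u0 d u t = t / n + d"
    if \<tau>: "\<tau> = 0" and u: "u \<in> J" for u t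
  proof -
    note P = rot_product[OF \<tau> F(2)]
    show "rot_xi1 \<kappa> \<tau> U n u = 2 * n * U u / (1 + sqrt (1 - \<kappa> * n\<^sup>2 * (U u)\<^sup>2))"
      by (rule P(1)[OF u u])
    show "rot_xi2 \<kappa> \<tau> U n u0 c u = c + primitive u0
      (\<lambda>w. sqrt ((1 - n\<^sup>2 * (\<kappa> * (U w)\<^sup>2 + (deriv U w)\<^sup>2)) / (1 - \<kappa> * n\<^sup>2 * (U w)\<^sup>2))) u"
      unfolding rot_xi2_def by (intro arg_cong[of _ _ "\<lambda>x. c + x"] pc u arg_cong[of _ _ sqrt] P(2))
    show "rot_theta \<kappa> \<tau> U n u0 d u t = t / n + d"
      by (simp add: rot_theta_def \<tau>)
  qed
  have Heisenberg: "rot_xi1 \<kappa> \<tau> U n u = sqrt 2 * n * U u / sqrt (1 + sqrt (rot_Delta \<kappa> \<tau> U n u))"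
    "rot_xi2 \<kappa> \<tau> U n u0 c u = c + primitive u0
      (\<lambda>w. (1 + sqrt (rot_Delta \<kappa> \<tau> U n w)) / 2
         * sqrt (2 / (1 + sqrt (rot_Delta \<kappa> \<tau> U n w)) - n\<^sup>2 * (deriv U w)\<^sup>2 / rot_Delta \<kappa> \<tau> U n w)) u"
    "rot_theta \<kappa> \<tau> U n u0 d u t = t / n + d + \<tau> * primitive u0
      (\<lambda>w. sqrt (2 / (1 + sqrt (rot_Delta \<kappa> \<tau> U n w)) - n\<^sup>2 * (deriv U w)\<^sup>2 / rot_Delta \<kappa> \<tau> U n w)) u"
    if \<kappa>: "\<kappa> = 0" and u: "u \<in> J" for u t
  proof -
    note H = rot_Heisenberg[OF \<kappa> F(2)]
    show "rot_xi1 \<kappa> \<tau> U n u = sqrt 2 * n * U u / sqrt (1 + sqrt (rot_Delta \<kappa> \<tau> U n u))"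
      by (rule H(1)[OF u u])
    show "rot_xi2 \<kappa> \<tau> U n u0 c u = c + primitive u0
      (\<lambda>w. (1 + sqrt (rot_Delta \<kappa> \<tau> U n w)) / 2
         * sqrt (2 / (1 + sqrt (rot_Delta \<kappa> \<tau> U n w)) - n\<^sup>2 * (deriv U w)\<^sup>2 / rot_Delta \<kappa> \<tau> U n w)) u"
      unfolding rot_xi2_def by (intro arg_cong[of _ _ "\<lambda>x. c + x"] pc u H(2))
    show "rot_theta \<kappa> \<tau> U n u0 d u t = t / n + d + \<tau> * primitive u0
      (\<lambda>w. sqrt (2 / (1 + sqrt (rot_Delta \<kappa> \<tau> U n w)) - n\<^sup>2 * (deriv U w)\<^sup>2 / rot_Delta \<kappa> \<tau> U n w)) u"
      unfolding rot_theta_def mult.commute[of 2 \<tau>] mult.assoc[of \<tau> 2] primitive_cmult[symmetric, of 2]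
      by (intro arg_cong[of _ _ "\<lambda>x. t / n + d + \<tau> * x"] pc u H(3))
  qed
  show ?thesis
  proof (intro conjI)
    show "\<exists>\<Phi>. bcv_isometry \<kappa> \<tau> \<Phi> \<and> (n > 0 \<longrightarrow> \<Phi> = id) \<and>
        (\<forall>u\<in>J. \<forall>t. rot \<kappa> \<tau> U n u0 c d (u, t) = \<Phi> (psi \<kappa> \<tau> U n 0 u0 c d (u, sgn n * t)))"
      by (rule rot_congruent_psi[OF J(2,3) U_pos n(2)])
    show "\<forall>n' u0' c' d'. u0' \<in> J \<and> psi_admissible \<kappa> \<tau> U n' 0 J \<longrightarrow>
        isometric_surfaces \<kappa> \<tau> (J \<times> UNIV) (rot \<kappa> \<tau> U n u0 c d)
          (J \<times> UNIV) (rot \<kappa> \<tau> U n' u0' c' d')"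
      using natural_imp_isometric[OF op rot(2)[OF J(3) n(2)] rot(2)] by blast
    show "\<forall>m a u0' c' d'. u0' \<in> J \<and> psi_admissible \<kappa> \<tau> U m a J \<longrightarrow>
        helicoidal_surface \<kappa> a (J \<times> UNIV) (psi \<kappa> \<tau> U m a u0' c' d') \<and>
        has_natural_form \<kappa> \<tau> U (J \<times> UNIV) (psi \<kappa> \<tau> U m a u0' c' d') \<and>
        isometric_surfaces \<kappa> \<tau> (J \<times> UNIV) (rot \<kappa> \<tau> U n u0 c d)
          (J \<times> UNIV) (psi \<kappa> \<tau> U m a u0' c' d')"
      by (intro allI impI conjI natural_imp_isometric[OF op rot(2)[OF J(3) n(2)]] psi) simp_all
  \<comment> \<open>Case (4) needs no further computation: it restates the general result for
    \<open>rot\<close>.\<close>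
  qed (use formulas S3 product Heisenberg rot[OF J(3) n(2)] psi[OF J(3) n(2)] in
      \<open>auto simp: rot_Delta_def\<close>)
qed

end
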